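(* Let $c>1$ and $p,q,r\ge0$ with $p+q+r=1$, $p+r>0$, $q+r>0$ be fixed and let $k\in\mathbb{Z}$. Then: (i) $\mu^{(k)}$ is absolutely continuous if and only if $\mu^{(0)}$ is absolutely continuous. (ii) $\mu^{(k)}$ is continuous-singular if and only if $\mu^{(0)}$ is continuous-singular. (iii) $\dim(\mu^{(k)})=\dim(\mu^{(0)})$.
   Context: For $k\in\mathbb{Z}$ let $\{(N_t^{(k)},L_t^{(k)}),t\ge0\}$ be the bivariate compound Poisson process (pure jump, no drift) with $E[e^{i(z_1N_t^{(k)}+z_2L_t^{(k)})}]=\exp[t\int_{\mathbb{R}^2}(e^{i(z_1x_1+z_2x_2)}-1)\nu^{(k)}(dx)]$, where $\nu^{(k)}$ is concentrated on the points $(1,0)$, $(0,1)$, $(1,c^{-k})$ with masses $u,v,w\ge0$ respectively, and $p=u/(u+v+w)$, $q=v/(u+v+w)$, $r=w/(u+v+w)$. Define $\mu^{(k)}$ as the distribution of $\int_0^{\infty-}c^{-N^{(k)}_{s-}}\,dL_s^{(k)}$ (the almost sure limit of $\int_0^t$ as $t\to\infty$, which exists). It depends on $u,v,w$ only through $p,q,r$. Absolute continuity and singularity are with respect to Lebesgue measure; continuous-singular means singular and without atoms. The dimension $\dim(\sigma)$ of a measure $\sigma$ on $\mathbb{R}$ is the infimum of the Hausdorff dimensions $\dim B$ over all Borel sets $B$ of full $\sigma$-measure. *)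

theory Defs
  imports "HOL-Probability.Probability"
begin

subsection \<open>Levy processes and compound Poisson processes\<close>

text \<open>
  Independence of \<open>X 0\<close> from the increments is automatic, since \<open>X 0 = 0\<close> almost surely.
  Stochastic continuity is not listed separately: it follows from stationarity of the
  increments, right-continuity at \<open>0\<close> and \<open>X 0 = 0\<close>.
\<close>
definition levy_process ::
  "'a measure \<Rightarrow> (real \<Rightarrow> 'a \<Rightarrow> 'b::euclidean_space) \<Rightarrow> bool" where
  "levy_process M X \<longleftrightarrow>
     prob_space M \<and>
     (\<forall>t\<ge>0. X t \<in> borel_measurable M) \<and>
     (AE \<omega> in M. X 0 \<omega> = 0) \<and>
     (\<forall>(n::nat) \<tau>. 0 \<le> \<tau> 0 \<and> (\<forall>i<n. \<tau> i \<le> \<tau> (Suc i)) \<longrightarrow>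
        prob_space.indep_vars M (\<lambda>_. borel) (\<lambda>i \<omega>. X (\<tau> (Suc i)) \<omega> - X (\<tau> i) \<omega>) {..<n}) \<and>
     (\<forall>s\<ge>0. \<forall>t\<ge>0. distr M borel (\<lambda>\<omega>. X (s + t) \<omega> - X s \<omega>) = distr M borel (X t)) \<and>
     (AE \<omega> in M.
        (\<forall>t\<ge>0. continuous (at_right t) (\<lambda>s. X s \<omega>)) \<and>
        (\<forall>t>0. \<exists>l. ((\<lambda>s. X s \<omega>) \<longlongrightarrow> l) (at_left t)))"

definition compound_poisson_process ::
  "'a measure \<Rightarrow> 'b measure \<Rightarrow> (real \<Rightarrow> 'a \<Rightarrow> 'b::euclidean_space) \<Rightarrow> bool" where
  "compound_poisson_process M \<nu> X \<longleftrightarrow>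
     levy_process M X \<and>
     (\<forall>t\<ge>0. \<forall>z. (LINT \<omega>|M. iexp (z \<bullet> X t \<omega>)) =
        exp (complex_of_real t * (LINT x|\<nu>. iexp (z \<bullet> x) - 1)))"

definition nu :: "real \<Rightarrow> int \<Rightarrow> real \<Rightarrow> real \<Rightarrow> real \<Rightarrow> (real \<times> real) measure" where
  "nu c k u v w =
     distr
       (point_measure {(1, 0), (0, 1), (1, c powi (- k))}
          (\<lambda>x. ennreal (if x = (1, 0) then u else if x = (0, 1) then v else w)))
       borel (\<lambda>x. x)"


subsection \<open>The exponential functional and its law\<close>

text \<open>
  The first component of \<open>X\<close> is \<open>N\<close>, the second is \<open>L\<close>. Since \<open>\<nu>\<close> is concentrated on points with
  nonnegative coordinates, almost every path of \<open>L\<close> is nondecreasing and right-continuous, so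
  the stochastic integral over \<open>(0, t]\<close> is the pathwise Lebesgue--Stieltjes integral.
  The path of \<open>L\<close> is extended to negative times by its value at \<open>0\<close>.
\<close>
definition functional_upto ::
  "real \<Rightarrow> (real \<Rightarrow> 'a \<Rightarrow> real \<times> real) \<Rightarrow> real \<Rightarrow> 'a \<Rightarrow> real" where
  "functional_upto c X t \<omega> =
     (LINT s:{0<..t}|interval_measure (\<lambda>s. snd (X (max 0 s) \<omega>)).
        c powr (- Lim (at_left s) (\<lambda>r. fst (X r \<omega>))))"

text \<open>
  \<open>is_mu c p q r k M \<mu>\<close>: the measure \<open>\<mu>\<close> is the law \<open>\<mu>\<^sup>k\<close>, realised through some process on
  the probability space \<open>M\<close>. The masses \<open>u, v, w\<close> only enter through the ratios \<open>p, q, r\<close>.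
\<close>
definition is_mu ::
  "real \<Rightarrow> real \<Rightarrow> real \<Rightarrow> real \<Rightarrow> int \<Rightarrow> 'a measure \<Rightarrow> real measure \<Rightarrow> bool" where
  "is_mu c p q r k M \<mu> \<longleftrightarrow>
     (\<exists>u v w X V.
        0 \<le> u \<and> 0 \<le> v \<and> 0 \<le> w \<and>
        p = u / (u + v + w) \<and> q = v / (u + v + w) \<and> r = w / (u + v + w) \<and>
        compound_poisson_process M (nu c k u v w) X \<and>
        V \<in> borel_measurable M \<and>
        (AE \<omega> in M. ((\<lambda>t. functional_upto c X t \<omega>) \<longlongrightarrow> V \<omega>) at_top) \<and>
        \<mu> = distr M borel V)"


subsection \<open>Continuous singularity\<close>

definition lebesgue_singular :: "real measure \<Rightarrow> bool" where
  "lebesgue_singular \<sigma> \<longleftrightarrow>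
     (\<exists>A\<in>sets borel. emeasure lborel A = 0 \<and> emeasure \<sigma> (- A) = 0)"

definition continuous_singular :: "real measure \<Rightarrow> bool" where
  "continuous_singular \<sigma> \<longleftrightarrow> lebesgue_singular \<sigma> \<and> (\<forall>x. emeasure \<sigma> {x} = 0)"


subsection \<open>Hausdorff dimension\<close>

text \<open>
  These are meant for \<open>s > 0\<close> only, because \<open>0 powr 0 = 0\<close>. The exponent \<open>0\<close> is not needed for
  the dimension: it does not change the infimum below.
\<close>
definition hausdorff_premeasure :: "real \<Rightarrow> real \<Rightarrow> 'a::metric_space set \<Rightarrow> ennreal" where
  "hausdorff_premeasure s \<delta> B =
     (INF U\<in>{U :: nat \<Rightarrow> 'a set. B \<subseteq> (\<Union>i. U i) \<and> (\<forall>i. bounded (U i) \<and> diameter (U i) \<le> \<delta>)}.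
        \<Sum>i. ennreal (diameter (U i) powr s))"

definition hausdorff_measure :: "real \<Rightarrow> 'a::metric_space set \<Rightarrow> ennreal" where
  "hausdorff_measure s B = (SUP \<delta>\<in>{0<..}. hausdorff_premeasure s \<delta> B)"

definition hausdorff_dim :: "'a::metric_space set \<Rightarrow> ennreal" where
  "hausdorff_dim B = (INF s\<in>{s. 0 < s \<and> hausdorff_measure s B = 0}. ennreal s)"

definition measure_dim :: "real measure \<Rightarrow> ennreal" where
  "measure_dim \<sigma> = (INF B\<in>{B \<in> sets borel. emeasure \<sigma> (- B) = 0}. hausdorff_dim B)"

end

theory Submission
  imports Defs
begin

text \<open>
  Let \<open>\<phi>\<^sub>k\<close> be the characteristic function of \<open>\<mu>\<^sup>k\<close>. Looking at the first jump of the process gives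
  \<open>\<phi>\<^sub>k z * (1 - q * iexp z) = (p + r * iexp (z * c powi (- k))) * \<phi>\<^sub>k (z / c)\<close>, and an equation of this
  form has only one solution that is continuous at \<open>0\<close> with value \<open>1\<close> there. Consequently
  \<open>\<phi>\<^sub>k z = (p + r * iexp (z * c powi (- k))) / (p + r) * \<phi>\<^sub>k\<^sub>+\<^sub>1 z\<close>: the law at level \<open>k\<close> is a mixture of the law
  at level \<open>k + 1\<close> and of its translate by \<open>c powi (- k)\<close>, with weights \<open>p / (p + r)\<close> and
  \<open>r / (p + r)\<close>. Mixing countably many translates changes neither absolute continuity, nor
  continuous singularity, nor the dimension.

  The functional equation is obtained without a construction of the jump times. Left Riemann sums
  of mesh \<open>h\<close> turn the functional into that of a random walk whose increments are distributed like
  \<open>(N\<^sub>h, L\<^sub>h)\<close>. Conditioning on the first increment makes the characteristic functions of the partial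
  sums an Euler scheme, with error of order \<open>h\<^sup>2\<close> per step, for the generator of the jumps. Letting
  first the mesh tend to \<open>0\<close> and then the time to infinity shows that \<open>\<phi>\<^sub>k\<close> is annihilated by the
  generator, which is the functional equation.
\<close>

subsection \<open>Mixtures of translates\<close>

lemma hausdorff_measure_zero_iff:
  "hausdorff_measure s B = 0 \<longleftrightarrow> (\<forall>\<delta>>0. hausdorff_premeasure s \<delta> B = 0)"
  unfolding hausdorff_measure_def bot_ennreal[symmetric] SUP_bot_conv by auto

lemma hausdorff_premeasure_zero_iff:
  "hausdorff_premeasure s \<delta> B = 0 \<longleftrightarrow>
    (\<forall>e>0. \<exists>U :: nat \<Rightarrow> 'a :: metric_space set. B \<subseteq> (\<Union>i. U i) \<and>
        (\<forall>i. bounded (U i) \<and> diameter (U i) \<le> \<delta>) \<and>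
        (\<Sum>i. ennreal (diameter (U i) powr s)) < e)"
proof -
  have "hausdorff_premeasure s \<delta> B = 0 \<longleftrightarrow> (\<forall>e>0. hausdorff_premeasure s \<delta> B < e)"
    by (metis less_irrefl not_gr_zero)
  also have "\<dots> \<longleftrightarrow> (\<forall>e>0. \<exists>U :: nat \<Rightarrow> 'a set. B \<subseteq> (\<Union>i. U i) \<and>
        (\<forall>i. bounded (U i) \<and> diameter (U i) \<le> \<delta>) \<and>
        (\<Sum>i. ennreal (diameter (U i) powr s)) < e)"
    unfolding hausdorff_premeasure_def INF_less_iff by (simp add: conj_assoc)
  finally show ?thesis .
qed

lemma hausdorff_premeasure_mono:
  "A \<subseteq> B \<Longrightarrow> hausdorff_premeasure s \<delta> A \<le> hausdorff_premeasure s \<delta> B"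
  unfolding hausdorff_premeasure_def by (intro INF_superset_mono) auto

text \<open>Geometric splitting of the error: covers of \<open>B n\<close> of weight below
  \<open>e' n\<close>, where the \<open>e' n\<close> sum to less than \<open>e\<close>, are merged
  into one sequence by \<open>prod_decode\<close>.\<close>

lemma hausdorff_premeasure_UN_zero:
  fixes B :: "nat \<Rightarrow> 'a :: metric_space set"
  assumes "\<And>n. hausdorff_premeasure s \<delta> (B n) = 0"
  shows "hausdorff_premeasure s \<delta> (\<Union>n. B n) = 0"
  unfolding hausdorff_premeasure_zero_iff
proof (intro allI impI)
  fix e :: ennreal assume "e > 0"
  obtain e' :: "nat \<Rightarrow> ennreal" where e': "\<And>n. e' n > 0" "(\<Sum>n. e' n) < e"
  proof -
    \<comment> \<open>A finite positive total below \<open>e\<close>, also when \<open>e\<close> is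
      infinite; the series with ratio \<open>1/2\<close> then distributes exactly
      \<open>d\<close>.\<close>
    define d :: real where "d = (if e = \<top> then 1 else enn2real e / 2)"
    have d: "d > 0" "ennreal d < e"
      using \<open>e > 0\<close> by (cases e; auto simp: d_def ennreal_less_iff)+
    have "(\<lambda>n. ennreal (d * (1/2) ^ Suc n)) sums ennreal (d * 1)"
      using d by (intro sums_mult power_half_series sums_ennreal[THEN iffD2]) auto
    with d show ?thesis
      by (intro that[of "\<lambda>n. ennreal (d * (1/2) ^ Suc n)"]) (auto simp: sums_iff)
  qed
  have "\<exists>U :: nat \<Rightarrow> 'a set. B n \<subseteq> (\<Union>i. U i) \<and> (\<forall>i. bounded (U i) \<and> diameter (U i) \<le> \<delta>) \<and>
        (\<Sum>i. ennreal (diameter (U i) powr s)) < e' n" for n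
    using assms[of n] e'(1)[of n] unfolding hausdorff_premeasure_zero_iff by blast
  then obtain U :: "nat \<Rightarrow> nat \<Rightarrow> 'a set" where
    U: "\<And>n. B n \<subseteq> (\<Union>i. U n i)" "\<And>n i. bounded (U n i)" "\<And>n i. diameter (U n i) \<le> \<delta>"
      "\<And>n. (\<Sum>i. ennreal (diameter (U n i) powr s)) < e' n"
    by metis
  define V where "V k = (case prod_decode k of (n, i) \<Rightarrow> U n i)" for k
  have V: "V (prod_encode (n, i)) = U n i" for n i by (simp add: V_def)
  have "(\<Sum>k. ennreal (diameter (V k) powr s)) = (\<Sum>n. \<Sum>i. ennreal (diameter (U n i) powr s))"
    using suminf_ennreal_2dimen[of _ "\<lambda>(n, i). ennreal (diameter (U n i) powr s)"]
    by (simp add: V_def case_prod_beta)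
  also have "\<dots> \<le> (\<Sum>n. e' n)"
    using U(4) by (intro suminf_le) (auto simp: less_imp_le)
  finally have "(\<Sum>k. ennreal (diameter (V k) powr s)) < e" using e'(2) by simp
  moreover have "(\<Union>n. B n) \<subseteq> (\<Union>k. V k)"
  proof
    fix x assume "x \<in> (\<Union>n. B n)"
    then obtain n where "x \<in> B n" by blast
    then obtain i where "x \<in> U n i" using U(1) by blast
    then show "x \<in> (\<Union>k. V k)" using V[of n i] by blast
  qed
  moreover have "bounded (V k) \<and> diameter (V k) \<le> \<delta>" for k
    by (simp add: V_def U(2,3) split: prod.split)
  ultimately show "\<exists>U. (\<Union>n. B n) \<subseteq> (\<Union>i. U i) \<and> (\<forall>i. bounded (U i) \<and> diameter (U i) \<le> \<delta>) \<and>
        (\<Sum>i. ennreal (diameter (U i) powr s)) < e"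
    by (intro exI[of _ V] conjI allI) auto
qed

text \<open>Translations are isometries, so a translated cover has the same diameters.\<close>

lemma hausdorff_premeasure_translation_zero:
  fixes B :: "'a :: real_normed_vector set"
  assumes "hausdorff_premeasure s \<delta> B = 0"
  shows "hausdorff_premeasure s \<delta> ((+) a ` B) = 0"
  unfolding hausdorff_premeasure_zero_iff
proof (intro allI impI)
  fix e :: ennreal assume "e > 0"
  with assms obtain U :: "nat \<Rightarrow> 'a set" where
    U: "B \<subseteq> (\<Union>i. U i)" "\<And>i. bounded (U i)" "\<And>i. diameter (U i) \<le> \<delta>"
      "(\<Sum>i. ennreal (diameter (U i) powr s)) < e"
    unfolding hausdorff_premeasure_zero_iff by metis
  have [simp]: "diameter ((+) a ` S) = diameter S" for S
  proof -
    have "(\<lambda>(x, y). dist x y) ` ((+) a ` S \<times> (+) a ` S) = (\<lambda>(x, y). dist x y) ` (S \<times> S)"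
      by (force simp: image_iff)
    then show ?thesis by (simp add: diameter_def)
  qed
  have "(+) a ` B \<subseteq> (\<Union>i. (+) a ` U i)"
    using image_mono[OF U(1)] by (simp only: image_UN)
  then show "\<exists>U. (+) a ` B \<subseteq> (\<Union>i. U i) \<and> (\<forall>i. bounded (U i) \<and> diameter (U i) \<le> \<delta>) \<and>
        (\<Sum>i. ennreal (diameter (U i) powr s)) < e"
    using U(2-4) by (intro exI[of _ "\<lambda>i. (+) a ` U i"]) (simp add: bounded_translation)
qed

text \<open>Only the vanishing of the premeasures enters the dimension, and it passes to translates
  and to countable unions. So every exponent that is admissible for \<open>B\<close> is admissible
  for the union.\<close>

lemma hausdorff_dim_countable_translates_le:
  fixes B :: "'a :: real_normed_vector set"
  assumes "countable F"
  shows "hausdorff_dim (\<Union>a\<in>F. (+) a ` B) \<le> hausdorff_dim B"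
  unfolding hausdorff_dim_def
proof (rule INF_superset_mono)
  have "hausdorff_premeasure s \<delta> (\<Union>a\<in>F. (+) a ` B) = 0" if "hausdorff_premeasure s \<delta> B = 0" for s \<delta>
  proof (cases "F = {}")
    case True
    then show ?thesis
      using hausdorff_premeasure_mono[of "{}" B s \<delta>] that by auto
  next
    case False
    \<comment> \<open>The enumeration by \<open>from_nat_into\<close> has range \<open>F\<close>
      only for nonempty \<open>F\<close>, hence the case distinction.\<close>
    have "(\<Union>a\<in>F. (+) a ` B) = (\<Union>n. (+) (from_nat_into F n) ` B)"
      by (subst range_from_nat_into[OF False assms, symmetric]) (simp only: image_image)
    then show ?thesis
      using hausdorff_premeasure_UN_zero[OF hausdorff_premeasure_translation_zero[OF that]]
      by (simp only:)
  qed
  then show "{s. 0 < s \<and> hausdorff_measure s B = 0}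
      \<subseteq> {s. 0 < s \<and> hausdorff_measure s (\<Union>a\<in>F. (+) a ` B) = 0}"
    by (simp add: hausdorff_measure_zero_iff subset_iff)
qed simp

section \<open>Convolutions with discrete laws, as countable mixtures of translates\<close>

definition translate_mixture :: "real pmf \<Rightarrow> real measure \<Rightarrow> real measure" where
  "translate_mixture D \<mu> = distr (measure_pmf D \<Otimes>\<^sub>M \<mu>) borel (\<lambda>(a, x). a + x)"

lemma borel_measurable_pmf_plus [measurable]:
  "sets \<mu> = sets borel \<Longrightarrow> (\<lambda>(a, x). a + x :: real) \<in> borel_measurable (measure_pmf D \<Otimes>\<^sub>M \<mu>)"
proof -
  assume [measurable_cong]: "sets \<mu> = sets borel"
  have [measurable]: "(\<lambda>x. x) \<in> measure_pmf D \<rightarrow>\<^sub>M (borel :: real measure)" by simp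
  show ?thesis by measurable
qed

lemma sets_translate_mixture [simp]: "sets (translate_mixture D \<mu>) = sets borel"
  by (simp add: translate_mixture_def)

lemma real_distribution_translate_mixture:
  assumes "real_distribution \<mu>"
  shows "real_distribution (translate_mixture D \<mu>)"
proof -
  interpret real_distribution \<mu> by fact
  interpret D: pair_prob_space "measure_pmf D" \<mu> ..
  show ?thesis unfolding translate_mixture_def
    by (intro D.P.real_distribution_distr) simp
qed

lemma char_translate_mixture:
  assumes "real_distribution \<mu>"
  shows "char (translate_mixture D \<mu>) t = (LINT a|D. iexp (t * a)) * char \<mu> t"
proof -
  interpret real_distribution \<mu> by fact
  interpret D: pair_prob_space "measure_pmf D" \<mu> ..
  note [measurable_cong] = events_eq_borel
  have [measurable]: "(\<lambda>x. x) \<in> measure_pmf D \<rightarrow>\<^sub>M (borel :: real measure)" by simp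
  have "char (translate_mixture D \<mu>) t =
      (LINT y|(measure_pmf D \<Otimes>\<^sub>M \<mu>). iexp (t * (fst y + snd y)))"
    unfolding char_def translate_mixture_def
    by (subst integral_distr) (auto simp: case_prod_beta)
  also have "\<dots> = (LINT a|D. LINT x|\<mu>. iexp (t * (a + x)))"
    by (subst D.integral_fst'[symmetric])
      (auto intro!: D.P.integrable_const_bound[of _ 1])
  also have "\<dots> = (LINT a|D. iexp (t * a) * char \<mu> t)"
    by (simp add: char_def ring_distribs exp_add)
  finally show ?thesis by simp
qed

text \<open>By Fubini the mass of \<open>N\<close> is the average over \<open>a\<close> of the
  masses of its shifted copies, and an average of nonnegative numbers is zero only if every term of
  positive weight is. The three invariance results below all rest on this criterion.\<close>

lemma emeasure_translate_mixture_eq_0_iff: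
  assumes "real_distribution \<mu>" and [measurable]: "N \<in> sets borel"
  shows "emeasure (translate_mixture D \<mu>) N = 0 \<longleftrightarrow> (\<forall>a\<in>set_pmf D. emeasure \<mu> ((+) a -` N) = 0)"
proof -
  interpret real_distribution \<mu> by fact
  interpret D: pair_prob_space "measure_pmf D" \<mu> ..
  have [measurable]: "(\<lambda>x. x) \<in> measure_pmf D \<rightarrow>\<^sub>M (borel :: real measure)" by simp
  have "emeasure (translate_mixture D \<mu>) N = (\<integral>\<^sup>+a. emeasure \<mu> ((+) a -` N) \<partial>D)"
    unfolding translate_mixture_def
    by (subst emeasure_distr, simp, simp, subst emeasure_pair_measure_alt[OF measurable_sets[of _ _ borel]])
      (auto simp: space_pair_measure vimage_def intro!: nn_integral_cong)
  also have "\<dots> = 0 \<longleftrightarrow> (\<forall>a\<in>set_pmf D. emeasure \<mu> ((+) a -` N) = 0)"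
    by (subst nn_integral_0_iff_AE) (auto simp: AE_measure_pmf_iff)
  finally show ?thesis .
qed

text \<open>Lebesgue null sets are stable under translation, so the criterion for null sets
  transfers in both directions; for the converse one atom of \<open>D\<close> is enough.\<close>

lemma absolutely_continuous_translate_mixture_iff:
  assumes \<mu>: "real_distribution \<mu>"
  shows "absolutely_continuous lborel (translate_mixture D \<mu>) \<longleftrightarrow> absolutely_continuous lborel \<mu>"
proof -
  interpret real_distribution \<mu> by fact
  have shift: "(+) a -` N \<in> null_sets lborel" if "N \<in> null_sets lborel" for a :: real and N
  proof -
    have [measurable]: "N \<in> sets borel" using that by auto
    have "emeasure lborel ((+) a -` N) = emeasure (distr lborel borel ((+) a)) N"
      by (subst emeasure_distr) auto
    with that show ?thesis
      by (auto simp: null_sets_def lborel_distr_plus intro!: measurable_sets_borel[of "(+) a" borel])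
  qed
  obtain a where a: "a \<in> set_pmf D" using set_pmf_not_empty by fast
  show ?thesis
  proof
    assume ac: "absolutely_continuous lborel \<mu>"
    show "absolutely_continuous lborel (translate_mixture D \<mu>)"
      unfolding absolutely_continuous_def
    proof
      fix N :: "real set" assume N: "N \<in> null_sets lborel"
      then have "emeasure \<mu> ((+) a -` N) = 0" for a :: real
        using shift[OF N, of a] ac by (auto simp: absolutely_continuous_def null_sets_def)
      then show "N \<in> null_sets (translate_mixture D \<mu>)"
        using N by (simp add: null_sets_def emeasure_translate_mixture_eq_0_iff[OF \<mu>])
    qed
  next
    assume ac: "absolutely_continuous lborel (translate_mixture D \<mu>)"
    show "absolutely_continuous lborel \<mu>"
      unfolding absolutely_continuous_def
    proof
      fix N :: "real set" assume N: "N \<in> null_sets lborel"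
      \<comment> \<open>\<open>N\<close> is moved by the atom \<open>a\<close> in advance, so that
        the preimage under \<open>(+) a\<close> is \<open>N\<close> again.\<close>
      have "(+) (-a) -` N \<in> null_sets (translate_mixture D \<mu>)"
        using ac shift[OF N] unfolding absolutely_continuous_def by blast
      then have "emeasure \<mu> ((+) a -` ((+) (-a) -` N)) = 0"
        using a by (auto simp: null_sets_def emeasure_translate_mixture_eq_0_iff[OF \<mu>])
      then show "N \<in> null_sets \<mu>"
        using N by (auto simp: null_sets_def vimage_def)
    qed
  qed
qed

text \<open>A null set carrying \<open>\<mu>\<close> is enlarged to the union of its translates by
  the atoms of \<open>D\<close>, which is still null because there are countably many. Conversely, a
  null set carrying the mixture is pulled back along one atom. Point masses are compared in the same
  way.\<close>

lemma continuous_singular_translate_mixture_iff: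
  assumes \<mu>: "real_distribution \<mu>"
  shows "continuous_singular (translate_mixture D \<mu>) \<longleftrightarrow> continuous_singular \<mu>"
proof -
  interpret real_distribution \<mu> by fact
  have shift: "(+) a ` N \<in> null_sets lborel" if "N \<in> null_sets lborel" for a :: real and N
  proof -
    have [measurable]: "N \<in> sets borel" using that by auto
    have eq: "(+) a ` N = (+) (-a) -` N"
      by (force simp: image_iff)
    have "emeasure lborel ((+) a ` N) = emeasure (distr lborel borel ((+) (-a))) N"
      unfolding eq by (subst emeasure_distr) auto
    with that show ?thesis
      by (auto simp: null_sets_def lborel_distr_plus eq intro!: measurable_sets_borel[of "(+) (-a)" borel])
  qed
  obtain a where a: "a \<in> set_pmf D" using set_pmf_not_empty by fast
  show ?thesis
  proof
    assume cs: "continuous_singular \<mu>"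
    then obtain A where A: "A \<in> sets borel" "emeasure lborel A = 0" "emeasure \<mu> (- A) = 0"
      by (auto simp: continuous_singular_def lebesgue_singular_def)
    define A' where "A' = (\<Union>a\<in>set_pmf D. (+) a ` A)"
    have A': "A' \<in> null_sets lborel"
      unfolding A'_def using A shift by (intro null_sets_UN') (auto simp: null_sets_def)
    have "emeasure \<mu> ((+) b -` (- A')) = 0" if "b \<in> set_pmf D" for b
    proof -
      have "(+) b -` (- A') \<subseteq> - A" using that by (auto simp: A'_def)
      then have "emeasure \<mu> ((+) b -` (- A')) \<le> emeasure \<mu> (- A)"
        using A by (intro emeasure_mono) auto
      with A show ?thesis by simp
    qed
    then have "lebesgue_singular (translate_mixture D \<mu>)"
      using A' unfolding lebesgue_singular_def
      by (intro bexI[of _ A']) (auto simp: null_sets_def emeasure_translate_mixture_eq_0_iff[OF \<mu>])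
    moreover have "emeasure \<mu> ((+) b -` {x}) = 0" for b x
    proof -
      have "(+) b -` {x} = {x - b}" by auto
      then show ?thesis using cs by (simp add: continuous_singular_def)
    qed
    ultimately show "continuous_singular (translate_mixture D \<mu>)"
      by (simp add: continuous_singular_def emeasure_translate_mixture_eq_0_iff[OF \<mu>])
  next
    assume cs: "continuous_singular (translate_mixture D \<mu>)"
    then obtain A where A: "A \<in> sets borel" "emeasure lborel A = 0"
        "emeasure (translate_mixture D \<mu>) (- A) = 0"
      by (auto simp: continuous_singular_def lebesgue_singular_def)
    have eq: "(+) (- a) ` A = (+) a -` A" by (force simp: image_iff)
    have "emeasure \<mu> ((+) a -` (- A)) = 0"
      using A a by (simp add: emeasure_translate_mixture_eq_0_iff[OF \<mu>])
    moreover have "(+) a -` A \<in> null_sets lborel"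
      using shift[of A "-a"] A unfolding eq by (auto simp: null_sets_def)
    ultimately have "lebesgue_singular \<mu>"
      unfolding lebesgue_singular_def
      by (intro bexI[of _ "(+) a -` A"]) (auto simp: null_sets_def vimage_Compl)
    moreover have "emeasure \<mu> {x} = 0" for x
    proof -
      have "emeasure \<mu> ((+) a -` {a + x}) = 0"
        using cs a emeasure_translate_mixture_eq_0_iff[OF \<mu>, of "{a + x}" D]
        by (auto simp: continuous_singular_def)
      moreover have "(+) a -` {a + x} = {x}" by auto
      ultimately show ?thesis by simp
    qed
    ultimately show "continuous_singular \<mu>"
      by (simp add: continuous_singular_def)
  qed
qed

text \<open>The union of the translates of a full set for \<open>\<mu>\<close> is full for the
  mixture and has no larger dimension. A full set for the mixture, moved back by one atom, is full
  for \<open>\<mu>\<close>.\<close>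

lemma measure_dim_translate_mixture:
  assumes \<mu>: "real_distribution \<mu>"
  shows "measure_dim (translate_mixture D \<mu>) = measure_dim \<mu>"
proof (rule antisym)
  interpret real_distribution \<mu> by fact
  show "measure_dim (translate_mixture D \<mu>) \<le> measure_dim \<mu>"
    unfolding measure_dim_def
  proof (rule INF_greatest)
    fix B assume "B \<in> {B \<in> sets borel. emeasure \<mu> (- B) = 0}"
    then have [measurable]: "B \<in> sets borel" and B: "emeasure \<mu> (- B) = 0" by auto
    define B' where "B' = (\<Union>a\<in>set_pmf D. (+) a ` B)"
    have "(+) a ` B \<in> sets borel" for a
    proof -
      have "(+) a ` B = (+) (-a) -` B" by (force simp: image_iff)
      then show ?thesis using measurable_sets_borel[of "(+) (-a)" borel B] by simp
    qed
    then have [measurable]: "B' \<in> sets borel"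
      unfolding B'_def by (intro sets.countable_UN') auto
    have "emeasure \<mu> ((+) b -` (- B')) = 0" if "b \<in> set_pmf D" for b
    proof -
      have "(+) b -` (- B') \<subseteq> - B" using that by (auto simp: B'_def)
      then have "emeasure \<mu> ((+) b -` (- B')) \<le> emeasure \<mu> (- B)"
        by (intro emeasure_mono) auto
      with B show ?thesis by simp
    qed
    then have "B' \<in> {B \<in> sets borel. emeasure (translate_mixture D \<mu>) (- B) = 0}"
      by (simp add: emeasure_translate_mixture_eq_0_iff[OF \<mu>])
    moreover have "hausdorff_dim B' \<le> hausdorff_dim B"
      unfolding B'_def by (intro hausdorff_dim_countable_translates_le) simp
    ultimately show "(INF B\<in>{B \<in> sets borel. emeasure (translate_mixture D \<mu>) (- B) = 0}.
        hausdorff_dim B) \<le> hausdorff_dim B"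
      by (rule INF_lower2)
  qed
  show "measure_dim \<mu> \<le> measure_dim (translate_mixture D \<mu>)"
    unfolding measure_dim_def
  proof (rule INF_greatest)
    fix B assume "B \<in> {B \<in> sets borel. emeasure (translate_mixture D \<mu>) (- B) = 0}"
    then have [measurable]: "B \<in> sets borel"
      and B: "emeasure (translate_mixture D \<mu>) (- B) = 0" by auto
    obtain a where a: "a \<in> set_pmf D" using set_pmf_not_empty by fast
    have eq: "(+) (- a) ` B = (+) a -` B" by (force simp: image_iff)
    have "emeasure \<mu> (- ((+) (- a) ` B)) = 0"
      using B a unfolding eq by (simp add: emeasure_translate_mixture_eq_0_iff[OF \<mu>] vimage_Compl)
    moreover have "(+) (- a) ` B \<in> sets borel"
      unfolding eq using measurable_sets_borel[of "(+) a" borel B] by simp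
    moreover have "hausdorff_dim ((+) (- a) ` B) \<le> hausdorff_dim B"
      using hausdorff_dim_countable_translates_le[of "{-a}" B] by simp
    ultimately show "(INF B\<in>{B \<in> sets borel. emeasure \<mu> (- B) = 0}. hausdorff_dim B)
        \<le> hausdorff_dim B"
      by (intro INF_lower2) auto
  qed
qed

subsection \<open>The functional equation and its consequences\<close>

text \<open>The distance of the two solutions at \<open>z\<close> is at most that at
  \<open>z / c\<close>. Iterating drives the argument to \<open>0\<close>, where both solutions are
  continuous and agree.\<close>

lemma functional_equation_unique:
  fixes f g a :: "real \<Rightarrow> complex"
  assumes "c > 1" and cont: "isCont f 0" "isCont g 0" and "f 0 = g 0"
    and f: "\<And>z. f z = a z * f (z / c)" and g: "\<And>z. g z = a z * g (z / c)"
    and a: "\<And>z. norm (a z) \<le> 1"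
  shows "f z = g z"
proof -
  define d where "d z = norm (f z - g z)" for z
  have step: "d z \<le> d (z / c)" for z
  proof -
    have "d z = norm (a z) * d (z / c)"
      unfolding d_def by (subst f, subst g) (simp add: norm_mult ring_distribs flip: right_diff_distrib)
    also have "\<dots> \<le> 1 * d (z / c)"
      using a by (intro mult_right_mono) (auto simp: d_def)
    finally show ?thesis by simp
  qed
  have iter: "d z \<le> d (z * (1 / c) ^ n)" for n
  proof (induction n)
    case (Suc n)
    then show ?case using step[of "z * (1 / c) ^ n"] by (simp add: mult.assoc)
  qed simp
  have "isCont d 0"
    unfolding d_def using cont by (intro continuous_intros)
  moreover have "(\<lambda>n. z * (1 / c) ^ n) \<longlonglongrightarrow> z * 0"
    using \<open>c > 1\<close> by (intro tendsto_mult_left LIMSEQ_power_zero) auto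
  ultimately have "(\<lambda>n. d (z * (1 / c) ^ n)) \<longlonglongrightarrow> d 0"
    using isCont_tendsto_compose[of 0 d] by simp
  then have "d z \<le> d 0"
    using iter by (intro LIMSEQ_le_const[where X = "\<lambda>n. d (z * (1 / c) ^ n)"]) simp_all
  with \<open>f 0 = g 0\<close> show ?thesis by (simp add: d_def)
qed

text \<open>The first-jump equation with its denominator multiplied out, so that it can be stated
  without knowing that \<open>1 - q * iexp z\<close> does not vanish.\<close>

definition functional_char :: "real \<Rightarrow> real \<Rightarrow> real \<Rightarrow> real \<Rightarrow> int \<Rightarrow> real measure \<Rightarrow> bool" where
  "functional_char c p q r k \<mu> \<longleftrightarrow> real_distribution \<mu> \<and>
    (\<forall>z. char \<mu> z * (1 - q * iexp z) = (p + r * iexp (z * c powi (- k))) * char \<mu> (z / c))"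

locale jump_ratios =
  fixes c p q r :: real
  assumes c_gt_1: "c > 1" and nonneg: "p \<ge> 0" "q \<ge> 0" "r \<ge> 0"
    and sum_eq_1: "p + q + r = 1" and pr_pos: "p + r > 0"
begin

lemma functional_char_unique:
  assumes "functional_char c p q r k \<mu>" "functional_char c p q r k \<mu>'"
  shows "\<mu> = \<mu>'"
proof -
  define a where "a z = (p + r * iexp (z * c powi (- k))) / (1 - q * iexp z)" for z :: real
  \<comment> \<open>Since \<open>p + r = 1 - q\<close>, the reverse triangle inequality bounds the
    denominator below by the same number that bounds the numerator above.\<close>
  have den: "norm (1 - q * iexp z) \<ge> p + r" for z :: real
  proof -
    have "p + r = norm (1 :: complex) - norm (q * iexp z)"
      using nonneg sum_eq_1 by (simp add: norm_mult)
    also have "\<dots> \<le> norm (1 - q * iexp z)" by (rule norm_triangle_ineq2)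
    finally show ?thesis .
  qed
  have a: "norm (a z) \<le> 1" for z
  proof -
    have "norm (p + r * iexp (z * c powi (- k))) \<le> norm (complex_of_real p) + norm (r * iexp (z * c powi (- k)))"
      by (rule norm_triangle_ineq)
    also have "\<dots> = p + r" using nonneg by (simp only: norm_mult norm_exp_i_times) simp
    also have "\<dots> \<le> norm (1 - q * iexp z)" by (rule den)
    finally show ?thesis
      using den[of z] pr_pos by (simp add: a_def norm_divide divide_le_eq_1)
  qed
  have eq: "char \<nu> z = a z * char \<nu> (z / c)" if "functional_char c p q r k \<nu>" for \<nu> z
  proof -
    have "1 - q * iexp z \<noteq> 0" using den[of z] pr_pos by auto
    then show ?thesis
      using that unfolding functional_char_def a_def times_divide_eq_left
      by (subst nonzero_eq_divide_eq) auto
  qed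
  interpret M1: real_distribution \<mu> using assms by (simp add: functional_char_def)
  interpret M2: real_distribution \<mu>' using assms by (simp add: functional_char_def)
  have "char \<mu> z = char \<mu>' z" for z
    using functional_equation_unique[OF c_gt_1 M1.isCont_char M2.isCont_char _
        eq[OF assms(1)] eq[OF assms(2)] a]
    by (simp add: M1.char_zero M2.char_zero)
  then show ?thesis
    by (intro Levy_uniqueness M1.real_distribution_axioms M2.real_distribution_axioms ext)
qed

text \<open>The characteristic function of \<open>D\<close> at \<open>z / c\<close> is, up to the
  factor \<open>p + r\<close>, the coefficient in the equation at level \<open>k + 1\<close>, and at
  \<open>z\<close> the one at level \<open>k\<close>. Multiplying the equation at level
  \<open>k + 1\<close> by the latter exchanges the two roles.\<close>

lemma functional_char_step:
  assumes "functional_char c p q r (k + 1) \<mu>"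
  obtains D where "functional_char c p q r k (translate_mixture D \<mu>)"
proof
  define D where
    "D = map_pmf (\<lambda>b. if b then c powi (- k) else 0) (bernoulli_pmf (r / (p + r)))"
  let ?b = "\<lambda>z. (p + r * iexp z) / (p + r)"
  have \<mu>: "real_distribution \<mu>"
    and feq: "\<And>z. char \<mu> z * (1 - q * iexp z) =
        (p + r * iexp (z * c powi (- (k + 1)))) * char \<mu> (z / c)"
    using assms by (auto simp: functional_char_def)
  have "0 \<le> r / (p + r)" "r / (p + r) \<le> 1" using nonneg pr_pos by auto
  moreover have "1 - r / (p + r) = p / (p + r)" using pr_pos by (simp add: field_simps)
  ultimately have "(LINT a|D. iexp (z * a)) = ?b (z * c powi (- k))" for z
    by (simp add: D_def integral_measure_pmf[of UNIV] UNIV_bool scaleR_conv_of_real add_divide_distrib)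
  then have char: "char (translate_mixture D \<mu>) z = ?b (z * c powi (- k)) * char \<mu> z" for z
    by (simp add: char_translate_mixture[OF \<mu>])
  have shift: "z / c * c powi (- k) = z * c powi (- (k + 1))" for z
    using c_gt_1 power_int_diff[of c "- k" 1] by simp
  show "functional_char c p q r k (translate_mixture D \<mu>)"
    unfolding functional_char_def
  proof (intro conjI allI real_distribution_translate_mixture \<mu>)
    fix z
    have "char (translate_mixture D \<mu>) z * (1 - q * iexp z) =
        ?b (z * c powi (- k)) * (char \<mu> z * (1 - q * iexp z))"
      by (simp add: char)
    also have "\<dots> = (p + r * iexp (z * c powi (- k))) *
        (?b (z / c * c powi (- k)) * char \<mu> (z / c))"
      unfolding feq shift by simp
    finally show "char (translate_mixture D \<mu>) z * (1 - q * iexp z) =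
        (p + r * iexp (z * c powi (- k))) * char (translate_mixture D \<mu>) (z / c)"
      by (simp add: char)
  qed
qed

text \<open>Each induction step replaces \<open>\<nu>\<close> by a mixture of its translates that
  solves the equation one level lower. At level \<open>k\<close> uniqueness identifies the result
  with \<open>\<mu>\<close>.\<close>

lemma functional_char_same_type:
  assumes "functional_char c p q r k \<mu>" "functional_char c p q r (k + int n) \<nu>"
  shows "(absolutely_continuous lborel \<mu> \<longleftrightarrow> absolutely_continuous lborel \<nu>) \<and>
    (continuous_singular \<mu> \<longleftrightarrow> continuous_singular \<nu>) \<and> measure_dim \<mu> = measure_dim \<nu>"
  using assms
proof (induction n arbitrary: \<nu>)
  case 0
  then show ?case using functional_char_unique[of k \<mu> \<nu>] by simp
next
  case (Suc n)
  have "functional_char c p q r (k + int n + 1) \<nu>" using Suc.prems by (simp add: ac_simps)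
  then obtain D where D: "functional_char c p q r (k + int n) (translate_mixture D \<nu>)"
    by (rule functional_char_step)
  have \<nu>: "real_distribution \<nu>" using Suc.prems by (simp add: functional_char_def)
  show ?case
    using Suc.IH[OF Suc.prems(1) D] absolutely_continuous_translate_mixture_iff[OF \<nu>, of D]
      continuous_singular_translate_mixture_iff[OF \<nu>, of D] measure_dim_translate_mixture[OF \<nu>, of D]
    by simp
qed

end

subsection \<open>Small-time law of the jumps\<close>

text \<open>Two distinct points have the same image for at most one slope \<open>y\<close>, so
  countably many points exclude only countably many slopes.\<close>

lemma ex_inj_projection:
  fixes E :: "(real \<times> real) set"
  assumes "countable E"
  obtains y where "inj_on (\<lambda>x. (1, y) \<bullet> x) E"
proof -
  \<comment> \<open>Pairs with equal second coordinates contribute just the value \<open>0\<close>,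
    because division by zero gives \<open>0\<close>.\<close>
  define bad where "bad = (\<lambda>(x, x'). (fst x - fst x') / (snd x' - snd x)) ` (E \<times> E)"
  have "countable bad" using assms by (simp add: bad_def)
  then obtain y where y: "y \<notin> bad"
    using uncountable_UNIV_real by (metis UNIV_eq_I)
  have "x = x'" if "x \<in> E" "x' \<in> E" "(1, y) \<bullet> x = (1, y) \<bullet> x'" for x x'
  proof (rule ccontr)
    assume "x \<noteq> x'"
    have *: "y * (snd x' - snd x) = fst x - fst x'"
      using that(3) by (simp add: inner_prod_def algebra_simps)
    with \<open>x \<noteq> x'\<close> have "snd x' \<noteq> snd x" by (auto simp: prod_eq_iff)
    with * have "y = (fst x - fst x') / (snd x' - snd x)" by (simp add: field_simps)
    with y that show False by (force simp: bad_def)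
  qed
  then show ?thesis by (intro that) (auto simp: inj_on_def)
qed

text \<open>
  The library has uniqueness of characteristic functions only on the line. For a law carried by
  a countable set, a linear functional that is injective on that set reduces to this case.
\<close>
lemma eq_distr_pmf_if_iexp_eq:
  fixes P :: "(real \<times> real) measure" and D :: "'a pmf" and Y :: "'a \<Rightarrow> real \<times> real"
  assumes "prob_space P" and sets_P: "sets P = sets borel" and "countable (range Y)"
    and eq: "\<And>z. (LINT x|P. iexp (z \<bullet> x)) = (LINT d|D. iexp (z \<bullet> Y d))"
  shows "P = distr D borel Y"
proof -
  interpret P: prob_space P by fact
  note [measurable_cong] = sets_P
  have distr_eq: "distr P borel (\<lambda>x. z \<bullet> x) = distr D borel (\<lambda>d. z \<bullet> Y d)" for z
  proof (rule Levy_uniqueness)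
    show "real_distribution (distr P borel (\<lambda>x. z \<bullet> x))"
      by (intro P.real_distribution_distr) measurable
    show "real_distribution (distr D borel (\<lambda>d. z \<bullet> Y d))"
      by (intro prob_space.real_distribution_distr prob_space_measure_pmf) measurable
    show "char (distr P borel (\<lambda>x. z \<bullet> x)) = char (distr D borel (\<lambda>d. z \<bullet> Y d))"
    proof
      fix t
      show "char (distr P borel (\<lambda>x. z \<bullet> x)) t = char (distr D borel (\<lambda>d. z \<bullet> Y d)) t"
        using eq[of "t *\<^sub>R z"] by (simp add: char_def integral_distr)
    qed
  qed
  have AE_proj: "AE x in P. z \<bullet> x \<in> range (\<lambda>d. z \<bullet> Y d)" for z
  proof -
    have "countable (range (\<lambda>d. z \<bullet> Y d))"
      using assms(3) countable_image[of "range Y" "\<lambda>x. z \<bullet> x"] by (simp add: image_image)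
    then have [measurable]: "range (\<lambda>d. z \<bullet> Y d) \<in> sets borel"
      by (rule sets.countable[rotated]) simp
    have "AE x in distr P borel (\<lambda>x. z \<bullet> x). x \<in> range (\<lambda>d. z \<bullet> Y d)"
      unfolding distr_eq by (subst AE_distr_iff) auto
    then show ?thesis by (subst (asm) AE_distr_iff) auto
  qed
  \<comment> \<open>The projections to the axes place both coordinates almost surely in countable
    sets, so \<open>P\<close> is carried by this countable grid.\<close>
  define E where "E = range (\<lambda>d. fst (Y d)) \<times> range (\<lambda>d. snd (Y d))"
  have "countable E"
    using assms(3) countable_image[of "range Y" fst] countable_image[of "range Y" snd]
    by (auto simp: E_def image_image)
  have E: "AE x in P. x \<in> E"
    using AE_proj[of "(1, 0)"] AE_proj[of "(0, 1)"]
    by (auto simp: E_def inner_prod_def mem_Times_iff)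
  have YE: "range Y \<subseteq> E" by (intro image_subsetI) (auto simp: E_def mem_Times_iff)
  obtain y where inj: "inj_on (\<lambda>x. (1, y) \<bullet> x) E"
    using ex_inj_projection[OF \<open>countable E\<close>] .
  show ?thesis
  proof (rule measure_eqI)
    fix A assume "A \<in> sets P"
    then have [measurable]: "A \<in> sets borel" by (simp add: sets_P)
    let ?g = "\<lambda>x. (1, y) \<bullet> x"
    have "countable (?g ` (A \<inter> E))" using \<open>countable E\<close> by blast
    then have [measurable]: "?g ` (A \<inter> E) \<in> sets borel"
      using sets.countable[of "?g ` (A \<inter> E)" "borel :: real measure"] by (simp del: inner_Pair)
    \<comment> \<open>Injectivity on \<open>E\<close> lets an event in the plane be recovered, up to
      a null set, from its image on the line, where the two laws are already known to agree.\<close>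
    have iff: "?g x \<in> ?g ` (A \<inter> E) \<longleftrightarrow> x \<in> A" if "x \<in> E" for x
      using inj_on_image_mem_iff[OF inj that, of "A \<inter> E"] that by blast
    have "emeasure P A = emeasure P {x \<in> space P. ?g x \<in> ?g ` (A \<inter> E)}"
      using E iff sets.sets_into_space[OF \<open>A \<in> sets P\<close>]
      by (intro emeasure_eq_AE) (auto elim!: eventually_mono)
    also have "\<dots> = emeasure (distr P borel ?g) (?g ` (A \<inter> E))"
      by (subst emeasure_distr, measurable) (simp add: vimage_def Int_def conj_commute)
    also have "\<dots> = emeasure D ((\<lambda>d. ?g (Y d)) -` (?g ` (A \<inter> E)))"
      unfolding distr_eq by (subst emeasure_distr) auto
    also have "(\<lambda>d. ?g (Y d)) -` (?g ` (A \<inter> E)) = Y -` A"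
      using iff YE by blast
    finally show "emeasure P A = emeasure (distr D borel Y) A"
      by (subst emeasure_distr) auto
  qed (simp add: sets_P)
qed

text \<open>The library's \<open>poisson_pmf\<close> requires a positive rate.\<close>
definition poisson0_pmf :: "real \<Rightarrow> nat pmf" where
  "poisson0_pmf a = (if a = 0 then return_pmf 0 else poisson_pmf a)"

lemma pmf_poisson0: "a \<ge> 0 \<Longrightarrow> pmf (poisson0_pmf a) n = a ^ n / fact n * exp (- a)"
  by (cases n) (auto simp: poisson0_pmf_def)

lemma iexp_poisson0:
  assumes "a \<ge> 0"
  shows "(LINT n|poisson0_pmf a. iexp (t * real n)) = exp (complex_of_real a * (iexp t - 1))"
proof -
  let ?f = "\<lambda>n. pmf (poisson0_pmf a) n *\<^sub>R iexp (t * real n)"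
  have "integrable (count_space UNIV) ?f"
    using integrable_pmf[of UNIV "poisson0_pmf a"] by (rule Bochner_Integration.integrable_bound) auto
  moreover have "?f sums (exp (- complex_of_real a) * exp (a * iexp t))"
  proof -
    have "(\<lambda>n. exp (- complex_of_real a) * ((a * iexp t) ^ n /\<^sub>R fact n)) sums
        (exp (- complex_of_real a) * exp (a * iexp t))"
      by (intro sums_mult exp_converges)
    moreover have "?f n = exp (- complex_of_real a) * ((a * iexp t) ^ n /\<^sub>R fact n)" for n
    proof -
      have "iexp (t * real n) = iexp t ^ n"
        by (simp add: exp_of_nat_mult[symmetric] ac_simps)
      then show ?thesis
        using assms
        by (simp add: pmf_poisson0 scaleR_conv_of_real power_mult_distrib divide_inverse exp_of_real[symmetric])
    qed
    ultimately show ?thesis by simp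
  qed
  ultimately have "integral\<^sup>L (count_space UNIV) ?f = exp (- complex_of_real a) * exp (a * iexp t)"
    by (metis sums_integral_count_space_nat sums_unique2)
  also have "\<dots> = exp (complex_of_real a * (iexp t - 1))"
    by (simp add: exp_add[symmetric] algebra_simps)
  finally show ?thesis
    unfolding measure_pmf_eq_density by (subst integral_density) auto
qed

text \<open>This makes Fubini available for products of discrete laws: on countable types the
  product sigma-algebra contains every set.\<close>

lemma measure_pair_pmf:
  fixes A :: "'a :: countable pmf" and B :: "'b :: countable pmf"
  shows "measure_pmf (pair_pmf A B) = measure_pmf A \<Otimes>\<^sub>M measure_pmf B"
proof (rule pair_measure_eqI[symmetric])
  show "sets (measure_pmf A \<Otimes>\<^sub>M measure_pmf B) = sets (measure_pmf (pair_pmf A B))"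
    by (subst sets_pair_countable[of UNIV UNIV]) auto
  fix X Y
  have "emeasure (pair_pmf A B) (X \<times> Y) = (\<integral>\<^sup>+a. \<integral>\<^sup>+b. indicator X a * indicator Y b \<partial>B \<partial>A)"
    by (subst nn_integral_indicator[symmetric]) (auto simp: nn_integral_pair_pmf' indicator_times)
  also have "\<dots> = emeasure A X * emeasure B Y"
    by (simp add: nn_integral_cmult nn_integral_multc)
  finally show "emeasure A X * emeasure B Y = emeasure (pair_pmf A B) (X \<times> Y)" ..
qed unfold_locales

lemma integral_pair_pmf_mult:
  fixes A :: "'a :: countable pmf" and B :: "'b :: countable pmf" and f g :: "_ \<Rightarrow> complex"
  assumes "\<And>a. norm (f a) \<le> 1" "\<And>b. norm (g b) \<le> 1"
  shows "(LINT x|pair_pmf A B. f (fst x) * g (snd x)) = (LINT a|A. f a) * (LINT b|B. g b)"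
proof -
  interpret pair_prob_space "measure_pmf A" "measure_pmf B" ..
  have "integrable (pair_pmf A B) (\<lambda>x. f (fst x) * g (snd x))"
    using assms by (intro measure_pmf.integrable_const_bound[of _ 1]) (auto simp: norm_mult mult_le_one)
  then show ?thesis
    unfolding measure_pair_pmf by (subst integral_fst'[symmetric]) auto
qed

definition jump_counts_pmf :: "real \<Rightarrow> real \<Rightarrow> real \<Rightarrow> (nat \<times> nat \<times> nat) pmf" where
  "jump_counts_pmf a b m = pair_pmf (poisson0_pmf a) (pair_pmf (poisson0_pmf b) (poisson0_pmf m))"

text \<open>The position after \<open>i\<close> jumps \<open>(1, 0)\<close>, \<open>j\<close> jumps
  \<open>(0, 1)\<close> and \<open>l\<close> jumps \<open>(1, \<kappa>)\<close>. With independent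
  Poisson counts it follows the law of the compound Poisson process at a fixed time.\<close>

definition jump_total :: "real \<Rightarrow> nat \<times> nat \<times> nat \<Rightarrow> real \<times> real" where
  "jump_total \<kappa> = (\<lambda>(i, j, l). (real i + real l, real j + \<kappa> * real l))"

lemma iexp_jump_total:
  assumes "a \<ge> 0" "b \<ge> 0" "m \<ge> 0"
  shows "(LINT x|jump_counts_pmf a b m. iexp (z \<bullet> jump_total \<kappa> x)) =
    exp (complex_of_real a * (iexp (fst z) - 1) + complex_of_real b * (iexp (snd z) - 1) + complex_of_real m * (iexp (fst z + \<kappa> * snd z) - 1))"
proof -
  have "iexp (z \<bullet> jump_total \<kappa> x) = iexp (fst z * real (fst x)) *
      (iexp (snd z * real (fst (snd x))) * iexp ((fst z + \<kappa> * snd z) * real (snd (snd x))))" for x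
    by (cases x) (simp add: jump_total_def inner_prod_def exp_add[symmetric] algebra_simps)
  then have "(LINT x|jump_counts_pmf a b m. iexp (z \<bullet> jump_total \<kappa> x)) =
      (LINT i|poisson0_pmf a. iexp (fst z * real i)) *
      ((LINT i|poisson0_pmf b. iexp (snd z * real i)) *
       (LINT i|poisson0_pmf m. iexp ((fst z + \<kappa> * snd z) * real i)))"
    unfolding jump_counts_pmf_def
    by (simp only: integral_pair_pmf_mult[of "\<lambda>i. iexp (fst z * real i)"
        "\<lambda>y. iexp (snd z * real (fst y)) * iexp ((fst z + \<kappa> * snd z) * real (snd y))"]
       integral_pair_pmf_mult[of "\<lambda>i. iexp (snd z * real i)"
        "\<lambda>i. iexp ((fst z + \<kappa> * snd z) * real i)"] norm_mult norm_exp_i_times)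
  then show ?thesis
    using assms by (simp only: iexp_poisson0) (simp add: exp_add[symmetric] algebra_simps)
qed

text \<open>Second-order control of the probability that no jump occurs. The upper bound comes from
  \<open>1 \<le> 1 + x ^ 3\<close> and the factorisation of \<open>1 + x ^ 3\<close>.\<close>

lemma exp_minus_bounds:
  fixes x :: real
  assumes "x \<ge> 0"
  shows "1 - x \<le> exp (- x)" "exp (- x) \<le> 1 - x + x\<^sup>2"
proof -
  show "1 - x \<le> exp (- x)" using exp_ge_add_one_self[of "-x"] by simp
  have "1 + x \<le> exp x" by (rule exp_ge_add_one_self)
  then have "exp (- x) \<le> 1 / (1 + x)"
    using assms by (simp add: exp_minus divide_simps)
  also have "\<dots> \<le> 1 - x + x\<^sup>2"
  proof -
    have "1 \<le> 1 + x ^ 3" using assms by simp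
    also have "\<dots> = (1 - x + x\<^sup>2) * (1 + x)" by (simp add: algebra_simps power2_eq_square power3_eq_cube)
    finally show ?thesis using assms by (simp add: pos_divide_le_eq)
  qed
  finally show "exp (- x) \<le> 1 - x + x\<^sup>2" .
qed

text \<open>Up to time \<open>h\<close> there is no jump with probability
  \<open>exp (- (\<Lambda> * h))\<close>, a single jump with \<open>\<Lambda> * h\<close> times
  that, and more jumps only with probability of order \<open>h\<^sup>2\<close>. The last factor in
  \<open>3 * (u + v + w)\<^sup>2 * h\<^sup>2\<close> has coefficient 3 because three errors arise,
  each of size at most \<open>\<Lambda>\<^sup>2 * h\<^sup>2\<close>.\<close>

lemma jump_counts_small_time:
  fixes F :: "real \<times> real \<Rightarrow> complex"
  assumes uvw: "u \<ge> 0" "v \<ge> 0" "w \<ge> 0" and "h \<ge> 0" and F: "\<And>x. norm (F x) \<le> 1"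
  shows "norm ((LINT x|jump_counts_pmf (u * h) (v * h) (w * h). F (jump_total \<kappa> x)) - F (0, 0) -
      complex_of_real h * (complex_of_real u * F (1, 0) + complex_of_real v * F (0, 1) + complex_of_real w * F (1, \<kappa>) - complex_of_real (u + v + w) * F (0, 0)))
    \<le> 3 * (u + v + w)\<^sup>2 * h\<^sup>2"
proof -
  define \<Lambda> where "\<Lambda> = u + v + w"
  define D where "D = jump_counts_pmf (u * h) (v * h) (w * h)"
  \<comment> \<open>The outcomes with at most one jump.\<close>
  let ?K = "{(0, 0, 0), (1, 0, 0), (0, 1, 0), (0, 0, 1)} :: (nat \<times> nat \<times> nat) set"
  define e where "e = exp (- (\<Lambda> * h))"
  have e: "1 - \<Lambda> * h \<le> e" "e \<le> 1 - \<Lambda> * h + (\<Lambda> * h)\<^sup>2" "e \<le> 1"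
    using exp_minus_bounds[of "\<Lambda> * h"] uvw \<open>h \<ge> 0\<close> by (auto simp: e_def \<Lambda>_def)
  have e_eq: "exp (- (u * h)) * (exp (- (v * h)) * exp (- (w * h))) = e"
    by (simp add: e_def \<Lambda>_def exp_add[symmetric] algebra_simps)
  have pmfs: "pmf D (0, 0, 0) = e" "pmf D (Suc 0, 0, 0) = u * h * e"
      "pmf D (0, Suc 0, 0) = v * h * e" "pmf D (0, 0, Suc 0) = w * h * e"
    using uvw \<open>h \<ge> 0\<close> by (simp_all add: D_def jump_counts_pmf_def pmf_pair pmf_poisson0 e_eq[symmetric])
  let ?G = "\<lambda>x. F (jump_total \<kappa> x)"
  have int: "integrable D (\<lambda>x. ?G x * indicator S x)" for S
    using F by (intro measure_pmf.integrable_const_bound[of _ 1]) (auto simp: indicator_def)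
  have "(LINT x|D. ?G x) = (LINT x|D. ?G x * indicator ?K x + ?G x * indicator (- ?K) x)"
    by (intro Bochner_Integration.integral_cong) (auto simp: indicator_def)
  also have "\<dots> = (LINT x|D. ?G x * indicator ?K x) + (LINT x|D. ?G x * indicator (- ?K) x)"
    by (intro Bochner_Integration.integral_add int)
  also have "(LINT x|D. ?G x * indicator ?K x) =
      complex_of_real e * F (0, 0) + complex_of_real (h * e) * (complex_of_real u * F (1, 0) + complex_of_real v * F (0, 1) + complex_of_real w * F (1, \<kappa>))"
    by (subst integral_measure_pmf[of ?K])
      (auto simp: pmfs jump_total_def scaleR_conv_of_real algebra_simps split: split_indicator_asm)
  finally have split: "(LINT x|D. ?G x) = complex_of_real e * F (0, 0) +
      complex_of_real (h * e) * (complex_of_real u * F (1, 0) + complex_of_real v * F (0, 1) + complex_of_real w * F (1, \<kappa>)) + (LINT x|D. ?G x * indicator (- ?K) x)" .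
  have "norm (LINT x|D. ?G x * indicator (- ?K) x) \<le> (LINT x|D. indicator (- ?K) x)"
  proof (intro order.trans[OF integral_norm_bound] integral_mono integrable_norm int)
    show "integrable D (indicator (- ?K) :: _ \<Rightarrow> real)"
      by (intro measure_pmf.integrable_const_bound[of _ 1]) (auto simp: indicator_def)
  qed (use F in \<open>auto simp: indicator_def\<close>)
  also have "\<dots> = measure D (- ?K)" by simp
  also have "\<dots> = 1 - measure D ?K"
    using measure_pmf.prob_compl[of ?K D] by (simp add: Compl_eq_Diff_UNIV)
  also have "measure D ?K = e + \<Lambda> * h * e"
    by (subst measure_measure_pmf_finite) (auto simp: pmfs \<Lambda>_def algebra_simps)
  \<comment> \<open>The probability of two or more jumps: inserting
    \<open>e \<ge> 1 - \<Lambda> * h\<close> makes it at most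
    \<open>1 - (1 - \<Lambda> * h) * (1 + \<Lambda> * h)\<close>.\<close>
  also have "1 - (e + \<Lambda> * h * e) \<le> \<Lambda>\<^sup>2 * h\<^sup>2"
  proof -
    have "(1 - \<Lambda> * h) * (1 + \<Lambda> * h) \<le> e * (1 + \<Lambda> * h)"
      using e uvw \<open>h \<ge> 0\<close> by (intro mult_right_mono) (auto simp: \<Lambda>_def)
    then show ?thesis by (simp add: algebra_simps power2_eq_square)
  qed
  finally have rest: "norm (LINT x|D. ?G x * indicator (- ?K) x) \<le> \<Lambda>\<^sup>2 * h\<^sup>2" .
  let ?J = "complex_of_real u * F (1, 0) + complex_of_real v * F (0, 1) + complex_of_real w * F (1, \<kappa>)"
  have J: "norm ?J \<le> \<Lambda>"
  proof -
    have "norm ?J \<le> norm (complex_of_real u * F (1, 0)) + norm (complex_of_real v * F (0, 1)) + norm (complex_of_real w * F (1, \<kappa>))"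
      by (intro norm_triangle_le add_mono) auto
    also have "\<dots> \<le> u * 1 + v * 1 + w * 1"
      unfolding norm_mult using uvw F by (intro add_mono mult_mono) auto
    finally show ?thesis by (simp add: \<Lambda>_def)
  qed
  have tri: "norm (a - b + d) \<le> norm a + norm b + norm d" for a b d :: complex
    using norm_triangle_ineq[of "a - b" d] norm_triangle_ineq4[of a b] by linarith
  let ?R = "LINT x|D. ?G x * indicator (- ?K) x"
  have 1: "norm (complex_of_real (e - (1 - \<Lambda> * h)) * F (0, 0)) \<le> (\<Lambda> * h)\<^sup>2 * 1"
    unfolding norm_mult norm_of_real by (rule mult_mono) (use e F in auto)
  have 2: "norm (complex_of_real (h * (1 - e)) * ?J) \<le> (h * (\<Lambda> * h)) * \<Lambda>"
  proof -
    have "\<bar>h * (1 - e)\<bar> \<le> h * (\<Lambda> * h)"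
      unfolding abs_mult by (rule mult_mono) (use e \<open>h \<ge> 0\<close> in auto)
    moreover have "0 \<le> h * (\<Lambda> * h)" using uvw \<open>h \<ge> 0\<close> by (simp add: \<Lambda>_def)
    ultimately show ?thesis
      unfolding norm_mult norm_of_real using J by (intro mult_mono) auto
  qed
  \<comment> \<open>The three errors: linearising the no-jump probability, replacing
    \<open>e\<close> by \<open>1\<close> in the single-jump terms, and dropping multiple
    jumps.\<close>
  have eq: "(LINT x|D. ?G x) - F (0, 0) - complex_of_real h * (?J - complex_of_real \<Lambda> * F (0, 0)) =
      complex_of_real (e - (1 - \<Lambda> * h)) * F (0, 0) - complex_of_real (h * (1 - e)) * ?J + ?R"
    unfolding split by (simp add: algebra_simps)
  have "norm ((LINT x|D. ?G x) - F (0, 0) -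
      complex_of_real h * (?J - complex_of_real \<Lambda> * F (0, 0))) \<le>
      (\<Lambda> * h)\<^sup>2 * 1 + (h * (\<Lambda> * h)) * \<Lambda> + \<Lambda>\<^sup>2 * h\<^sup>2"
    unfolding eq by (rule order.trans[OF tri add_mono[OF add_mono[OF 1 2] rest]])
  also have "\<dots> = 3 * \<Lambda>\<^sup>2 * h\<^sup>2" by (simp add: power2_eq_square algebra_simps)
  finally show ?thesis unfolding D_def \<Lambda>_def .
qed

subsection \<open>Random walks with independent increments\<close>

text \<open>\<open>discounted_sum c x m\<close> is the exponential functional of the walk with increments \<open>x 0, x 1, \<dots>\<close>.\<close>
definition discounted_sum :: "real \<Rightarrow> (nat \<Rightarrow> real \<times> real) \<Rightarrow> nat \<Rightarrow> real" where
  "discounted_sum c x m = (\<Sum>i<m. c powr (- (\<Sum>l<i. fst (x l))) * snd (x i))"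

text \<open>All later discount factors contain \<open>c powr (- fst (x 0))\<close>. This
  self-similarity is what turns conditioning on the first increment into a recursion.\<close>

lemma discounted_sum_Suc:
  "discounted_sum c x (Suc m) = snd (x 0) + c powr (- fst (x 0)) * discounted_sum c (\<lambda>i. x (Suc i)) m"
  if "c > 0"
proof -
  have "discounted_sum c x (Suc m) = snd (x 0) + (\<Sum>i<m. c powr (- (\<Sum>l<Suc i. fst (x l))) * snd (x (Suc i)))"
    using that unfolding discounted_sum_def by (subst sum.lessThan_Suc_shift) simp
  also have "(\<Sum>i<m. c powr (- (\<Sum>l<Suc i. fst (x l))) * snd (x (Suc i))) =
      (\<Sum>i<m. c powr (- fst (x 0)) * (c powr (- (\<Sum>l<i. fst (x (Suc l)))) * snd (x (Suc i))))"
    by (intro sum.cong refl, subst sum.lessThan_Suc_shift) (simp add: powr_add[symmetric] algebra_simps)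
  finally show ?thesis by (simp add: discounted_sum_def sum_distrib_left)
qed

lemma borel_measurable_fst_snd_real [measurable]:
  "fst \<in> borel_measurable (borel :: (real \<times> real) measure)"
  "snd \<in> borel_measurable (borel :: (real \<times> real) measure)"
  by (auto intro!: borel_measurable_continuous_onI continuous_intros)

lemma borel_measurable_discounted_sum [measurable]:
  "(\<And>i. i < m \<Longrightarrow> (\<lambda>\<omega>. x \<omega> i) \<in> borel_measurable M) \<Longrightarrow>
    (\<lambda>\<omega>. discounted_sum c (x \<omega>) m) \<in> borel_measurable M"
proof -
  assume m: "\<And>i. i < m \<Longrightarrow> (\<lambda>\<omega>. x \<omega> i) \<in> borel_measurable M"
  have [measurable]: "(\<lambda>\<omega>. fst (x \<omega> i)) \<in> borel_measurable M"
      "(\<lambda>\<omega>. snd (x \<omega> i)) \<in> borel_measurable M" if "i < m" for i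
    using measurable_compose[OF m[OF that] borel_measurable_fst_snd_real(1)]
      measurable_compose[OF m[OF that] borel_measurable_fst_snd_real(2)] by auto
  show ?thesis
    unfolding discounted_sum_def
    by (intro borel_measurable_sum borel_measurable_times powr_real_measurable borel_measurable_uminus)
      auto
qed

text \<open>The characteristic function of \<open>discounted_sum c x m\<close> for independent
  increments of law \<open>P\<close>, obtained by conditioning on the first increment.\<close>

primrec discounted_char :: "real \<Rightarrow> (real \<times> real) measure \<Rightarrow> nat \<Rightarrow> real \<Rightarrow> complex" where
  "discounted_char c P 0 z = 1"
| "discounted_char c P (Suc m) z =
    (LINT x|P. iexp (z * snd x) * discounted_char c P m (z * c powr (- fst x)))"

lemma borel_measurable_discounted_char [measurable]:
  assumes "prob_space P" and [measurable_cong]: "sets P = sets borel"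
  shows "discounted_char c P m \<in> borel_measurable borel"
proof (induction m)
  case (Suc m)
  interpret prob_space P by fact
  note [measurable] = Suc.IH
  have [measurable]: "fst \<in> borel_measurable P" "snd \<in> borel_measurable P"
    by (simp_all add: measurable_cong_sets[OF assms(2) refl] borel_measurable_fst_snd_real)
  show ?case by (simp, measurable)
qed (simp add: discounted_char.simps(1)[abs_def])

text \<open>
  The constant second component is there because \<open>indep_var\<close> needs both variables to have the same type.
\<close>
lemma (in prob_space) indep_increments_split:
  fixes \<xi> :: "nat \<Rightarrow> 'a \<Rightarrow> real \<times> real"
  assumes indep: "\<And>n. indep_vars (\<lambda>_. borel) \<xi> {..<n}"
  shows "indep_var borel (\<xi> j) borel (\<lambda>\<omega>. (discounted_sum c (\<lambda>i. \<xi> (Suc j + i) \<omega>) m, 0))"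
proof -
  let ?B = "{Suc j..<Suc j + m}"
  have ind: "indep_var (PiM {j} (\<lambda>_. borel)) (\<lambda>\<omega>. restrict (\<lambda>i. \<xi> i \<omega>) {j})
      (PiM ?B (\<lambda>_. borel)) (\<lambda>\<omega>. restrict (\<lambda>i. \<xi> i \<omega>) ?B)"
    by (rule indep_var_restrict[OF indep[of "Suc j + m"]]) auto
  have "indep_var borel ((\<lambda>f. f j) \<circ> (\<lambda>\<omega>. restrict (\<lambda>i. \<xi> i \<omega>) {j}))
      borel ((\<lambda>f. (discounted_sum c (\<lambda>i. f (Suc j + i)) m, 0)) \<circ> (\<lambda>\<omega>. restrict (\<lambda>i. \<xi> i \<omega>) ?B))"
    by (rule indep_var_compose[OF ind])
      (auto intro!: borel_measurable_discounted_sum measurable_component_singleton)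
  also have "(\<lambda>f. f j) \<circ> (\<lambda>\<omega>. restrict (\<lambda>i. \<xi> i \<omega>) {j}) = \<xi> j" by auto
  also have "(\<lambda>f. (discounted_sum c (\<lambda>i. f (Suc j + i)) m, 0)) \<circ> (\<lambda>\<omega>. restrict (\<lambda>i. \<xi> i \<omega>) ?B) =
      (\<lambda>\<omega>. (discounted_sum c (\<lambda>i. \<xi> (Suc j + i) \<omega>) m, 0))"
    by (auto simp: discounted_sum_def fun_eq_iff intro!: sum.cong)
  finally show ?thesis .
qed

lemma (in prob_space) iexp_discounted_sum:
  fixes \<xi> :: "nat \<Rightarrow> 'a \<Rightarrow> real \<times> real"
  assumes "c > 0" and indep: "\<And>n. indep_vars (\<lambda>_. borel) \<xi> {..<n}"
    and distr: "\<And>i. distr M borel (\<xi> i) = P"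
  shows "(LINT \<omega>|M. iexp (z * discounted_sum c (\<lambda>i. \<xi> (j + i) \<omega>) m)) = discounted_char c P m z"
\<comment> \<open>The start \<open>j\<close> must vary, since the tail begins at
  \<open>Suc j\<close>; \<open>z\<close> must vary, since the first increment rescales it.\<close>
proof (induction m arbitrary: j z)
  case 0
  then show ?case by (simp add: discounted_sum_def prob_space)
next
  case (Suc m)
  have [measurable]: "\<xi> i \<in> borel_measurable M" for i
    using indep[of "Suc i"] by (auto simp: indep_vars_def)
  have P: "prob_space P" "sets P = sets borel"
    unfolding distr[symmetric, of 0] by (auto intro: prob_space_distr)
  let ?S = "\<lambda>\<omega>. discounted_sum c (\<lambda>i. \<xi> (Suc j + i) \<omega>) m"
  have [measurable]: "?S \<in> borel_measurable M" by (intro borel_measurable_discounted_sum) simp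
  let ?S' = "distr M borel (\<lambda>\<omega>. (?S \<omega>, 0 :: real))"
  interpret P: prob_space P by fact
  interpret S: prob_space ?S' by (rule prob_space_distr) simp
  interpret PS: pair_prob_space P ?S' ..
  note [measurable_cong] = P(2)
  have [measurable]: "fst \<in> borel_measurable P" "snd \<in> borel_measurable P"
    by (simp_all add: measurable_cong_sets[OF P(2) refl] borel_measurable_fst_snd_real)
  let ?f = "\<lambda>x (s :: real \<times> real). iexp (z * (snd x + c powr (- fst x) * fst s))"
  \<comment> \<open>Independence of the first increment from the tail makes the joint law a product,
    so Fubini performs the conditioning.\<close>
  have joint: "distr M (borel \<Otimes>\<^sub>M borel) (\<lambda>\<omega>. (\<xi> j \<omega>, ?S \<omega>, 0)) = P \<Otimes>\<^sub>M ?S'"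
    using indep_increments_split[OF indep, of j c m] unfolding indep_var_distribution_eq distr by simp
  have [measurable]: "(\<lambda>(x, s). ?f x s) \<in> borel_measurable (P \<Otimes>\<^sub>M ?S')" by measurable
  have sets_eq: "sets (P \<Otimes>\<^sub>M ?S') = sets (borel \<Otimes>\<^sub>M borel)"
    by (intro sets_pair_measure_cong) (auto simp: P)
  have "(LINT \<omega>|M. iexp (z * discounted_sum c (\<lambda>i. \<xi> (j + i) \<omega>) (Suc m))) =
      (LINT \<omega>|M. (\<lambda>(x, s). ?f x s) (\<xi> j \<omega>, ?S \<omega>, 0))"
    by (simp add: discounted_sum_Suc[OF \<open>c > 0\<close>])
  also have "\<dots> = (LINT y|(P \<Otimes>\<^sub>M ?S'). (\<lambda>(x, s). ?f x s) y)"
    unfolding joint[symmetric]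
    by (subst integral_distr) (auto simp: measurable_cong_sets[OF sets_eq[symmetric] refl])
  also have "\<dots> = (LINT x|P. LINT s|?S'. ?f x s)"
  proof (subst PS.integral_fst'[symmetric])
    show "integrable (P \<Otimes>\<^sub>M ?S') (\<lambda>(x, s). ?f x s)"
      by (rule PS.P.integrable_const_bound[of _ 1]) (auto simp: case_prod_beta)
  qed simp
  also have "\<dots> = (LINT x|P. iexp (z * snd x) * discounted_char c P m (z * c powr (- fst x)))"
  proof (intro Bochner_Integration.integral_cong refl)
    fix x
    have "(LINT s|?S'. ?f x s) = (LINT s|?S'. iexp (z * snd x) * iexp (z * c powr (- fst x) * fst s))"
      by (simp add: exp_add[symmetric] algebra_simps)
    also have "\<dots> = iexp (z * snd x) * (LINT \<omega>|M. iexp (z * c powr (- fst x) * ?S \<omega>))"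
      by (subst integral_mult_right_zero, subst integral_distr) auto
    finally show "(LINT s|?S'. ?f x s) = iexp (z * snd x) * discounted_char c P m (z * c powr (- fst x))"
      unfolding Suc.IH .
  qed
  finally show ?case by simp
qed

lemma norm_discounted_char_le_1:
  assumes "prob_space P" and [measurable_cong]: "sets P = sets borel"
  shows "norm (discounted_char c P m z) \<le> 1"
proof (induction m arbitrary: z)
  case (Suc m)
  interpret prob_space P by fact
  note [measurable] = borel_measurable_discounted_char[OF assms]
  have [measurable]: "fst \<in> borel_measurable P" "snd \<in> borel_measurable P"
    by (simp_all add: measurable_cong_sets[OF assms(2) refl] borel_measurable_fst_snd_real)
  have "norm (discounted_char c P (Suc m) z) \<le>
      (LINT x|P. norm (iexp (z * snd x) * discounted_char c P m (z * c powr (- fst x))))"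
    by (simp only: discounted_char.simps) (rule integral_norm_bound)
  also have "\<dots> \<le> 1"
    using Suc.IH by (intro integral_le_const integrable_const_bound) (auto simp: norm_mult)
  finally show ?case .
qed simp

subsection \<open>Riemann sums for Stieltjes integrals\<close>

lemma finite_interval_measure_Ioc:
  fixes F :: "real \<Rightarrow> real"
  assumes mono: "\<And>x y. x \<le> y \<Longrightarrow> F x \<le> F y" and cont: "\<And>a. continuous (at_right a) F"
  shows "emeasure (interval_measure F) {a<..b} < \<infinity>"
  by (simp add: emeasure_interval_measure_Ioc_eq[OF mono cont])

text \<open>The sums are integrals of step functions that take the value of \<open>G\<close> at the
  left end of the cell containing \<open>s\<close>. These left ends tend to \<open>s\<close>
  strictly from below, which yields the left limit \<open>g s\<close>. Dominated convergence applies
  because \<open>(0, t]\<close> has finite measure.\<close>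

lemma left_Riemann_sum_tendsto_set_integral:
  fixes F G g :: "real \<Rightarrow> real" and h :: "nat \<Rightarrow> real" and m :: "nat \<Rightarrow> nat"
  assumes mono: "\<And>x y. x \<le> y \<Longrightarrow> F x \<le> F y" and cont: "\<And>a. continuous (at_right a) F"
    and h: "\<And>n. h n > 0" "h \<longlonglongrightarrow> 0" and mh: "\<And>n. real (m n) * h n = t"
    and bound: "\<And>s. s \<ge> 0 \<Longrightarrow> \<bar>G s\<bar> \<le> B"
    and left: "\<And>s. 0 < s \<Longrightarrow> s \<le> t \<Longrightarrow> (G \<longlongrightarrow> g s) (at_left s)"
  shows "(\<lambda>n. \<Sum>i<m n. G (real i * h n) * (F (real (Suc i) * h n) - F (real i * h n)))
    \<longlonglongrightarrow> (LINT s:{0<..t}|interval_measure F. g s)"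
proof -
  let ?M = "interval_measure F"
  note fin = finite_interval_measure_Ioc[of F, OF mono cont]
  define I where "I n i = {real i * h n<..real (Suc i) * h n}" for n i
  define f where "f n s = (\<Sum>i<m n. G (real i * h n) * indicator (I n i) s)" for n s
  have I_disj: "i = j" if "s \<in> I n i" "s \<in> I n j" for s n i j
  proof -
    have "real i * h n < real (Suc j) * h n" "real j * h n < real (Suc i) * h n"
      using that by (auto simp: I_def)
    then have "real i < real (Suc j)" "real j < real (Suc i)"
      using h(1)[of n] by (auto simp only: mult_less_cancel_right_pos)
    then show ?thesis by linarith
  qed
  have f_eq: "f n s = G (real i * h n)" if "s \<in> I n i" "i < m n" for n i s
  proof -
    have "f n s = (\<Sum>j<m n. if j = i then G (real i * h n) else 0)"
      unfolding f_def using that I_disj by (intro sum.cong) (auto simp: indicator_def)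
    with that show ?thesis by simp
  qed
  have ex_i: "\<exists>i<m n. s \<in> I n i" if "s \<in> {0<..t}" for n s
  proof -
    \<comment> \<open>Cells are open on the left and closed on the right, so a point on the grid
      belongs to the cell ending there; hence the ceiling minus one.\<close>
    define i where "i = nat (\<lceil>s / h n\<rceil> - 1)"
    have "s / h n > 0" using that h(1)[of n] by simp
    then have "\<lceil>s / h n\<rceil> \<ge> 1" by linarith
    then have i: "real i < s / h n" "s / h n \<le> real (Suc i)"
      unfolding i_def by linarith+
    have "s / h n \<le> real (m n)"
      using that mh[of n] h(1)[of n] by (simp add: pos_divide_le_eq)
    with i(1) have "i < m n" by linarith
    moreover have "s \<in> I n i"
      using i h(1)[of n] by (simp add: I_def pos_less_divide_eq pos_divide_le_eq)
    ultimately show ?thesis by blast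
  qed
  have f_zero: "f n s = 0" if "s \<notin> {0<..t}" for n s
  proof -
    have "s \<notin> I n i" if "i < m n" for i
    proof
      assume "s \<in> I n i"
      then have s: "real i * h n < s" "s \<le> real (Suc i) * h n" by (auto simp: I_def)
      have "real (Suc i) * h n \<le> real (m n) * h n"
        using h(1)[of n] that by (intro mult_right_mono) auto
      moreover have "0 \<le> real i * h n" using h(1)[of n] by simp
      ultimately show False using s \<open>s \<notin> {0<..t}\<close> mh[of n] by auto
    qed
    then show ?thesis by (auto simp: f_def)
  qed
  have [measurable]: "f n \<in> borel_measurable ?M" for n
    unfolding f_def I_def by measurable
  have bound_f: "\<bar>f n s\<bar> \<le> B * indicator {0<..t} s" for n s
  proof (cases "s \<in> {0<..t}")
    case True
    then obtain i where "i < m n" "s \<in> I n i" using ex_i by blast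
    with True show ?thesis using bound[of "real i * h n"] h(1)[of n] by (simp add: f_eq)
  qed (simp add: f_zero)
  have lim: "(\<lambda>n. f n s) \<longlonglongrightarrow> indicator {0<..t} s *\<^sub>R g s" for s
  proof (cases "s \<in> {0<..t}")
    case True
    then obtain i where i: "\<And>n. i n < m n" "\<And>n. s \<in> I n (i n)" using ex_i by metis
    let ?p = "\<lambda>n. real (i n) * h n"
    have p: "?p n < s" "s - h n \<le> ?p n" for n
      using i(2)[of n] by (auto simp: I_def algebra_simps)
    have "?p \<longlonglongrightarrow> s"
    proof (rule tendsto_sandwich)
      show "(\<lambda>n. s - h n) \<longlonglongrightarrow> s" using tendsto_diff[OF tendsto_const h(2), of s] by simp
    qed (use p in \<open>auto intro!: always_eventually less_imp_le\<close>)
    then have "filterlim ?p (at_left s) sequentially"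
      using p(1) less_imp_neq[OF p(1)] by (simp add: filterlim_at)
    with left[of s] True have "(\<lambda>n. G (?p n)) \<longlonglongrightarrow> g s"
      by (auto intro: filterlim_compose)
    moreover have "f n s = G (?p n)" for n using i f_eq by blast
    ultimately show ?thesis using True by simp
  qed (simp add: f_zero)
  have "(\<lambda>n. integral\<^sup>L ?M (f n)) \<longlonglongrightarrow> (LINT s|?M. indicator {0<..t} s *\<^sub>R g s)"
  proof (rule integral_dominated_convergence)
    show "integrable ?M (\<lambda>s. B * indicator {0<..t} s)"
      using fin by (intro integrable_mult_right integrable_real_indicator) auto
    show "(\<lambda>s. indicator {0<..t} s *\<^sub>R g s) \<in> borel_measurable ?M"
      by (rule borel_measurable_LIMSEQ_metric[OF _ lim]) simp
  qed (use lim bound_f in auto)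
  moreover have "integral\<^sup>L ?M (f n) =
      (\<Sum>i<m n. G (real i * h n) * (F (real (Suc i) * h n) - F (real i * h n)))" for n
  proof -
    have "integral\<^sup>L ?M (f n) = (\<Sum>i<m n. G (real i * h n) * measure ?M (I n i))"
      unfolding f_def using fin by (subst Bochner_Integration.integral_sum) (auto simp: I_def)
    also have "\<dots> = (\<Sum>i<m n. G (real i * h n) * (F (real (Suc i) * h n) - F (real i * h n)))"
      unfolding I_def using h(1)[of n]
      by (intro sum.cong refl arg_cong2[where f = "(*)"] measure_interval_measure_Ioc mono cont mult_right_mono) auto
    finally show ?thesis .
  qed
  ultimately show ?thesis by (simp add: set_lebesgue_integral_def)
qed

text \<open>By right-continuity a violation \<open>f y < f x\<close> persists at rationals just to
  the right of \<open>x\<close> and of \<open>y\<close>. It is used to extend an almost sure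
  statement from countably many times to all times.\<close>

lemma mono_if_mono_on_Rats:
  fixes f :: "real \<Rightarrow> real"
  assumes cont: "\<And>x. x \<ge> 0 \<Longrightarrow> continuous (at_right x) f"
    and mono: "\<And>x y. x \<in> \<rat> \<Longrightarrow> y \<in> \<rat> \<Longrightarrow> 0 \<le> x \<Longrightarrow> x \<le> y \<Longrightarrow> f x \<le> f y"
    and "0 \<le> x" "x \<le> y"
  shows "f x \<le> f y"
proof (rule ccontr)
  assume "\<not> f x \<le> f y"
  then have "f y < f x" "x < y" using \<open>x \<le> y\<close> by (auto simp: order_less_le)
  then obtain a where a: "f y < a" "a < f x" using dense by blast
  have "eventually (\<lambda>s. a < f s) (at_right x)"
    using cont[OF \<open>0 \<le> x\<close>] a(2) unfolding continuous_within by (rule order_tendstoD)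
  then obtain b where b: "b > x" "\<And>s. x < s \<Longrightarrow> s < b \<Longrightarrow> a < f s"
    unfolding eventually_at_right_field by blast
  have "eventually (\<lambda>s. f s < a) (at_right y)"
    using cont[of y] \<open>0 \<le> x\<close> \<open>x \<le> y\<close> a(1) unfolding continuous_within by (intro order_tendstoD) auto
  then obtain d where d: "d > y" "\<And>s. y < s \<Longrightarrow> s < d \<Longrightarrow> f s < a"
    unfolding eventually_at_right_field by blast
  \<comment> \<open>Taking \<open>s\<close> below \<open>y\<close> as well keeps it before
    \<open>t\<close>.\<close>
  obtain s where s: "s \<in> \<rat>" "x < s" "s < min b y"
    using Rats_dense_in_real[of x "min b y"] b \<open>x < y\<close> by auto
  obtain t where t: "t \<in> \<rat>" "y < t" "t < d"
    using Rats_dense_in_real[of y d] d by auto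
  have "a < f s" "f t < a" using b d s t by auto
  moreover have "f s \<le> f t" using s t \<open>0 \<le> x\<close> by (intro mono) auto
  ultimately show False by simp
qed

subsection \<open>Derivation of the functional equation\<close>

lemma integral_nu:
  fixes g :: "real \<times> real \<Rightarrow> complex"
  assumes "c > 0" "0 \<le> u" "0 \<le> v" "0 \<le> w" and [measurable]: "g \<in> borel_measurable borel"
  shows "(LINT x|nu c k u v w. g x) = u * g (1, 0) + v * g (0, 1) + w * g (1, c powi (- k))"
proof -
  \<comment> \<open>The three atoms are therefore distinct, and the \<open>if\<close> in
    \<open>nu\<close> gives each its own mass.\<close>
  have "c powi (- k) \<noteq> 0" using assms by simp
  then have "(1, 0) \<noteq> (1 :: real, c powi (- k))" "(0, 1) \<noteq> (1 :: real, c powi (- k))" by auto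
  with assms show ?thesis
    unfolding nu_def
    by (subst integral_distr, simp add: measurable_def, simp,
        subst lebesgue_integral_point_measure_finite)
      (auto simp: scaleR_conv_of_real)
qed

text \<open>The generator acting on characteristic functions: a jump \<open>(x, y)\<close>
  multiplies by \<open>iexp (z * y)\<close> and rescales the argument by
  \<open>c powr (- x)\<close>.\<close>

definition jump_generator ::
  "real \<Rightarrow> int \<Rightarrow> real \<Rightarrow> real \<Rightarrow> real \<Rightarrow> (real \<Rightarrow> complex) \<Rightarrow> real \<Rightarrow> complex" where
  "jump_generator c k u v w f z = u * f (z / c) + v * (iexp z * f z) +
     w * (iexp (z * c powi (- k)) * f (z / c)) - complex_of_real (u + v + w) * f z"

lemma jump_generator_diff:
  "jump_generator c k u v w f z - jump_generator c k u v w g z =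
    jump_generator c k u v w (\<lambda>y. f y - g y) z"
  by (simp add: jump_generator_def algebra_simps)

lemma norm_jump_generator_le:
  assumes "0 \<le> u" "0 \<le> v" "0 \<le> w" and f: "\<And>y. norm (f y) \<le> B"
  shows "norm (jump_generator c k u v w f z) \<le> 2 * (u + v + w) * B"
proof -
  have "norm (jump_generator c k u v w f z) \<le>
      norm (u * f (z / c)) + norm (v * (iexp z * f z)) +
      norm (w * (iexp (z * c powi (- k)) * f (z / c))) + norm (complex_of_real (u + v + w) * f z)"
    unfolding jump_generator_def
    by (intro order.trans[OF norm_triangle_ineq4] order.trans[OF norm_triangle_ineq] add_mono order.refl)
  also have "\<dots> \<le> u * B + v * B + w * B + (u + v + w) * B"
    unfolding norm_mult norm_exp_i_times norm_of_real
    using assms by (intro add_mono mult_mono) auto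
  finally show ?thesis by (simp add: algebra_simps)
qed

text \<open>Over \<open>n\<close> steps the generator is frozen at its initial value. Each step
  moves the scheme by order \<open>h\<close>, so freezing costs order \<open>(n * h)\<^sup>2\<close>
  in total. The bound is in terms of the elapsed time \<open>n * h\<close>, which is why the mesh
  can be refined at fixed time.\<close>

lemma Euler_scheme_error:
  fixes a :: "nat \<Rightarrow> real \<Rightarrow> complex"
  assumes uvw: "0 \<le> u" "0 \<le> v" "0 \<le> w" and h: "0 \<le> h" "h \<le> 1" and K: "K \<ge> 0"
    and a: "\<And>m z. norm (a m z) \<le> 1"
    and step: "\<And>m z. norm (a (Suc m) z - a m z - h * jump_generator c k u v w (a m) z) \<le> K * h\<^sup>2"
  defines "\<Lambda> \<equiv> u + v + w"
  shows "norm (a (m + n) z - a m z - complex_of_real (n * h) * jump_generator c k u v w (a m) z)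
    \<le> (K + 2 * \<Lambda> * (2 * \<Lambda> + K)) * (n * h)\<^sup>2"
proof -
  let ?G = "jump_generator c k u v w"
  \<comment> \<open>A Lipschitz constant per unit time: \<open>2 * \<Lambda>\<close> from the
    generator, and \<open>K\<close> from the local error since
    \<open>h\<^sup>2 \<le> h\<close>.\<close>
  define D where "D = 2 * \<Lambda> + K"
  have "\<Lambda> \<ge> 0" "D \<ge> 0" using uvw K by (auto simp: \<Lambda>_def D_def)
  have lip1: "norm (a (Suc m) z - a m z) \<le> D * h" for m z
  proof -
    have "norm (a (Suc m) z - a m z) \<le>
        norm (a (Suc m) z - a m z - h * ?G (a m) z) + norm (h * ?G (a m) z)"
      using norm_triangle_ineq[of "a (Suc m) z - a m z - h * ?G (a m) z" "h * ?G (a m) z"] by simp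
    also have "\<dots> \<le> K * h\<^sup>2 + h * (2 * \<Lambda>)"
      using step norm_jump_generator_le[OF uvw, of "a m" 1 c k z] a h
      by (intro add_mono) (auto simp: norm_mult \<Lambda>_def intro!: mult_left_mono)
    also have "K * h\<^sup>2 \<le> K * h" 
      using h K by (intro mult_left_mono) (auto simp: power2_eq_square mult_left_le)
    finally show ?thesis by (simp add: D_def algebra_simps)
  qed
  have lip: "norm (a (m + i) z - a m z) \<le> i * (D * h)" for i z
  proof (induction i)
    case (Suc i)
    have "norm (a (m + Suc i) z - a m z) \<le>
        norm (a (Suc (m + i)) z - a (m + i) z) + norm (a (m + i) z - a m z)"
      using norm_triangle_ineq[of "a (Suc (m + i)) z - a (m + i) z" "a (m + i) z - a m z"] by simp
    also have "\<dots> \<le> D * h + i * (D * h)" using lip1 Suc by (intro add_mono) auto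
    finally show ?case by (simp add: algebra_simps)
  qed simp
  have "norm (a (m + n) z - a m z - complex_of_real (n * h) * ?G (a m) z)
      \<le> n * (K * h\<^sup>2) + 2 * \<Lambda> * D * (n * h)\<^sup>2"
  proof (induction n)
    case (Suc n)
    let ?x = "a (m + n) z - a m z - complex_of_real (n * h) * ?G (a m) z"
    let ?y = "a (Suc (m + n)) z - a (m + n) z - h * ?G (a (m + n)) z"
    let ?w = "h * (?G (a (m + n)) z - ?G (a m) z)"
    \<comment> \<open>Accumulated error, local error of the new step, and drift of the generator
      since step \<open>m\<close>.\<close>
    have "a (m + Suc n) z - a m z - complex_of_real (Suc n * h) * ?G (a m) z = ?x + ?y + ?w"
      by (simp add: algebra_simps)
    then have "norm (a (m + Suc n) z - a m z - complex_of_real (Suc n * h) * ?G (a m) z)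
        \<le> norm ?x + norm ?y + norm ?w"
      by (simp only:) (intro order.trans[OF norm_triangle_ineq] add_right_mono norm_triangle_ineq)
    also have "\<dots> \<le> (n * (K * h\<^sup>2) + 2 * \<Lambda> * D * (n * h)\<^sup>2) + K * h\<^sup>2 +
        h * (2 * \<Lambda> * (n * (D * h)))"
      using h norm_jump_generator_le[OF uvw, of "\<lambda>y. a (m + n) y - a m y", OF lip]
      by (intro add_mono Suc step)
        (auto simp: norm_mult jump_generator_diff \<Lambda>_def intro!: mult_left_mono)
    also have "\<dots> \<le> Suc n * (K * h\<^sup>2) + 2 * \<Lambda> * D * (Suc n * h)\<^sup>2"
    proof -
      have "0 \<le> \<Lambda> * D * (h\<^sup>2 * (n + 1))" using \<open>\<Lambda> \<ge> 0\<close> \<open>D \<ge> 0\<close> by simp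
      then show ?thesis by (simp add: power2_eq_square algebra_simps)
    qed
    finally show ?case .
  qed simp
  also have "n * (K * h\<^sup>2) \<le> K * (n * h)\<^sup>2"
  proof -
    have "real n \<le> real n * real n" by (cases n) auto
    then show ?thesis
      using K mult_left_mono[of "real n" "real n * real n" "K * h\<^sup>2"]
      by (simp add: power2_eq_square algebra_simps)
  qed
  finally show ?thesis by (simp add: D_def algebra_simps)
qed

section \<open>The exponential functional as a limit of random walks\<close>

locale exponential_functional = prob_space M for M :: "'a measure" +
  fixes c :: real and k :: int and u v w :: real and X :: "real \<Rightarrow> 'a \<Rightarrow> real \<times> real" and V :: "'a \<Rightarrow> real"
  assumes c_gt_1: "c > 1" and uvw: "0 \<le> u" "0 \<le> v" "0 \<le> w"
    and cpp: "compound_poisson_process M (nu c k u v w) X"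
    and V_measurable [measurable]: "V \<in> borel_measurable M"
    and V_lim: "AE \<omega> in M. ((\<lambda>t. functional_upto c X t \<omega>) \<longlongrightarrow> V \<omega>) at_top"
begin

lemma X_measurable [measurable]: "t \<ge> 0 \<Longrightarrow> X t \<in> borel_measurable M"
  using cpp by (auto simp: compound_poisson_process_def levy_process_def)

text \<open>Both sides have the same characteristic function, and the right-hand law is carried by a
  countable set.\<close>

lemma distr_X:
  assumes "h \<ge> 0"
  shows "distr M borel (X h) =
    distr (jump_counts_pmf (u * h) (v * h) (w * h)) borel (jump_total (c powi (- k)))"
proof (rule eq_distr_pmf_if_iexp_eq)
  show "prob_space (distr M borel (X h))" using assms by (intro prob_space_distr) simp
  fix z :: "real \<times> real"
  have "(LINT x|distr M borel (X h). iexp (z \<bullet> x)) = (LINT \<omega>|M. iexp (z \<bullet> X h \<omega>))"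
    using assms by (subst integral_distr) auto
  also have "\<dots> = exp (complex_of_real h * (LINT x|nu c k u v w. iexp (z \<bullet> x) - 1))"
    using cpp assms unfolding compound_poisson_process_def by blast
  also have "\<dots> = (LINT d|jump_counts_pmf (u * h) (v * h) (w * h). iexp (z \<bullet> jump_total (c powi (- k)) d))"
    using uvw assms c_gt_1
    by (subst integral_nu, simp, simp, simp, simp, simp, subst iexp_jump_total)
      (auto simp: inner_prod_def algebra_simps)
  finally show "(LINT x|distr M borel (X h). iexp (z \<bullet> x)) =
      (LINT d|jump_counts_pmf (u * h) (v * h) (w * h). iexp (z \<bullet> jump_total (c powi (- k)) d))" .
qed auto

lemma distr_increment:
  assumes "0 \<le> s" "0 \<le> t"
  shows "distr M borel (\<lambda>\<omega>. X (s + t) \<omega> - X s \<omega>) = distr M borel (X t)"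
  using cpp assms by (simp add: compound_poisson_process_def levy_process_def)

lemma AE_increment_nonneg:
  assumes "0 \<le> s" "s \<le> t"
  shows "AE \<omega> in M. fst (X s \<omega>) \<le> fst (X t \<omega>) \<and> snd (X s \<omega>) \<le> snd (X t \<omega>)"
proof -
  have [measurable]: "{x :: real \<times> real. 0 \<le> fst x \<and> 0 \<le> snd x} \<in> sets borel"
    using borel_measurable_fst_snd_real by measurable
  have "AE x in distr M borel (X (t - s)). 0 \<le> fst x \<and> 0 \<le> snd x"
    unfolding distr_X[OF diff_ge_0_iff_ge[THEN iffD2, OF assms(2)]]
    using c_gt_1 by (subst AE_distr_iff) (auto simp: jump_total_def)
  then have "AE x in distr M borel (\<lambda>\<omega>. X (s + (t - s)) \<omega> - X s \<omega>). 0 \<le> fst x \<and> 0 \<le> snd x"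
    by (subst distr_increment) (use assms in auto)
  then show ?thesis
    using assms by (subst (asm) AE_distr_iff) auto
qed

definition good_path :: "'a \<Rightarrow> bool" where
  "good_path \<omega> \<longleftrightarrow> X 0 \<omega> = 0 \<and>
    (\<forall>t\<ge>0. continuous (at_right t) (\<lambda>s. X s \<omega>)) \<and>
    (\<forall>t>0. \<exists>l. ((\<lambda>s. X s \<omega>) \<longlongrightarrow> l) (at_left t)) \<and>
    (\<forall>s t. 0 \<le> s \<longrightarrow> s \<le> t \<longrightarrow> fst (X s \<omega>) \<le> fst (X t \<omega>) \<and> snd (X s \<omega>) \<le> snd (X t \<omega>))"

text \<open>Monotonicity holds almost surely for each pair of times, hence simultaneously for all
  rational pairs; right-continuity extends it to all times.\<close>

lemma AE_good_path: "AE \<omega> in M. good_path \<omega>"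
proof -
  let ?Q = "{(s, t). s \<in> \<rat> \<and> t \<in> \<rat> \<and> 0 \<le> s \<and> s \<le> (t :: real)}"
  have "?Q \<subseteq> \<rat> \<times> \<rat>" by auto
  then have "countable ?Q" using countable_subset countable_SIGMA countable_rat by blast
  then have "AE \<omega> in M. \<forall>q\<in>?Q. fst (X (fst q) \<omega>) \<le> fst (X (snd q) \<omega>) \<and>
      snd (X (fst q) \<omega>) \<le> snd (X (snd q) \<omega>)"
    using AE_increment_nonneg by (subst AE_ball_countable) auto
  moreover have "AE \<omega> in M. X 0 \<omega> = 0"
    "AE \<omega> in M. (\<forall>t\<ge>0. continuous (at_right t) (\<lambda>s. X s \<omega>)) \<and>
      (\<forall>t>0. \<exists>l. ((\<lambda>s. X s \<omega>) \<longlongrightarrow> l) (at_left t))"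
    using cpp by (auto simp: compound_poisson_process_def levy_process_def)
  ultimately show ?thesis
  proof eventually_elim
    case (elim \<omega>)
    then have cont: "continuous (at_right t) (\<lambda>s. fst (X s \<omega>))" "continuous (at_right t) (\<lambda>s. snd (X s \<omega>))"
      if "t \<ge> 0" for t
      using that by (auto intro: continuous_fst continuous_snd)
    have "fst (X s \<omega>) \<le> fst (X t \<omega>)" if "0 \<le> s" "s \<le> t" for s t
      by (rule mono_if_mono_on_Rats[OF cont(1) _ that]) (use elim(1) in auto)
    moreover have "snd (X s \<omega>) \<le> snd (X t \<omega>)" if "0 \<le> s" "s \<le> t" for s t
      by (rule mono_if_mono_on_Rats[OF cont(2) _ that]) (use elim(1) in auto)
    ultimately show ?case using elim(2,3) by (simp add: good_path_def)
  qed
qed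

definition increment :: "real \<Rightarrow> nat \<Rightarrow> 'a \<Rightarrow> real \<times> real" where
  "increment h i \<omega> = X (real (Suc i) * h) \<omega> - X (real i * h) \<omega>"

lemma discounted_sum_increment:
  assumes "X 0 \<omega> = 0"
  shows "discounted_sum c (\<lambda>i. increment h i \<omega>) m =
    (\<Sum>i<m. c powr (- fst (X (real i * h) \<omega>)) *
       (snd (X (real (Suc i) * h) \<omega>) - snd (X (real i * h) \<omega>)))"
proof -
  have "(\<Sum>l<i. fst (increment h l \<omega>)) = fst (X (real i * h) \<omega>)" for i
    using sum_lessThan_telescope[of "\<lambda>l. fst (X (real l * h) \<omega>)" i] assms
    by (simp add: increment_def)
  then show ?thesis by (simp add: discounted_sum_def increment_def)
qed

text \<open>After telescoping, the discounted sum is a left Riemann sum for the Stieltjes integral.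
  The mesh \<open>\<delta> / real (Suc n)\<close> is chosen so that \<open>j * Suc n\<close> steps
  end exactly at time \<open>real j * \<delta>\<close>.\<close>

lemma discounted_sum_tendsto_functional_upto:
  assumes "good_path \<omega>" "\<delta> > 0"
  shows "(\<lambda>n. discounted_sum c (\<lambda>i. increment (\<delta> / real (Suc n)) i \<omega>) (j * Suc n))
    \<longlonglongrightarrow> functional_upto c X (real j * \<delta>) \<omega>"
proof -
  let ?N = "\<lambda>s. fst (X s \<omega>)" and ?L = "\<lambda>s. snd (X (max 0 s) \<omega>)"
  let ?h = "\<lambda>n. \<delta> / real (Suc n)"
  have X0: "X 0 \<omega> = 0" and cont: "\<And>t. t \<ge> 0 \<Longrightarrow> continuous (at_right t) (\<lambda>s. X s \<omega>)"
    and left: "\<And>t. t > 0 \<Longrightarrow> \<exists>l. ((\<lambda>s. X s \<omega>) \<longlongrightarrow> l) (at_left t)"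
    and mono: "\<And>s t. 0 \<le> s \<Longrightarrow> s \<le> t \<Longrightarrow> ?N s \<le> ?N t"
      "\<And>s t. 0 \<le> s \<Longrightarrow> s \<le> t \<Longrightarrow> snd (X s \<omega>) \<le> snd (X t \<omega>)"
    using assms(1) by (auto simp: good_path_def)
  have N_nonneg: "?N s \<ge> 0" if "s \<ge> 0" for s
    using mono(1)[of 0 s] X0 that by simp
  \<comment> \<open>The interval measure requires right-continuity on the whole line; left of
    \<open>0\<close> the extended path is constant.\<close>
  have L_cont: "continuous (at_right a) ?L" for a
  proof (cases "a \<ge> 0")
    case True
    have "((\<lambda>s. snd (X s \<omega>)) \<longlongrightarrow> snd (X a \<omega>)) (at_right a)"
      using cont[OF True] unfolding continuous_within by (rule tendsto_snd)
    moreover have "eventually (\<lambda>s. snd (X s \<omega>) = ?L s) (at_right a)"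
      using eventually_at_right_less[of a] by eventually_elim (use True in auto)
    ultimately have "(?L \<longlongrightarrow> snd (X a \<omega>)) (at_right a)" by (rule Lim_transform_eventually)
    with True show ?thesis by (simp add: continuous_within max_def)
  next
    case False
    then have "eventually (\<lambda>s. s < 0) (at_right a)"
      unfolding eventually_at_right_field by (intro exI[of _ 0]) auto
    then have "eventually (\<lambda>s. ?L a = ?L s) (at_right a)"
      by eventually_elim (use False in \<open>auto simp: max_def\<close>)
    then show ?thesis unfolding continuous_within
      by (rule Lim_transform_eventually[OF tendsto_const])
  qed
  have "(\<lambda>n. \<Sum>i<j * Suc n. c powr (- ?N (real i * ?h n)) *
      (?L (real (Suc i) * ?h n) - ?L (real i * ?h n)))
    \<longlonglongrightarrow> (LINT s:{0<..real j * \<delta>}|interval_measure ?L. c powr (- Lim (at_left s) ?N))"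
  proof (rule left_Riemann_sum_tendsto_set_integral[where B = 1])
    show "?L x \<le> ?L y" if "x \<le> y" for x y using that by (intro mono) auto
    show "?h \<longlonglongrightarrow> 0"
      using LIMSEQ_Suc[OF lim_const_over_n[of \<delta>]] by simp
    show "\<bar>c powr (- ?N s)\<bar> \<le> 1" if "s \<ge> 0" for s
      using N_nonneg[OF that] c_gt_1 by (simp add: powr_minus inverse_le_1_iff ge_one_powr_ge_zero)
    show "((\<lambda>s. c powr (- ?N s)) \<longlongrightarrow> c powr (- Lim (at_left s) ?N)) (at_left s)" if s: "0 < s" for s
    proof -
      obtain l where "((\<lambda>s. X s \<omega>) \<longlongrightarrow> l) (at_left s)" using left[OF s] by blast
      then have N: "(?N \<longlongrightarrow> fst l) (at_left s)" by (rule tendsto_fst)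
      then have "Lim (at_left s) ?N = fst l" by (intro tendsto_Lim) auto
      with N show ?thesis using c_gt_1 by (auto intro!: tendsto_powr tendsto_minus)
    qed
    show "real (j * Suc n) * ?h n = real j * \<delta>" for n
      unfolding of_nat_mult by (simp del: of_nat_Suc)
  qed (use L_cont \<open>\<delta> > 0\<close> in auto)
  also have "(\<lambda>n. \<Sum>i<j * Suc n. c powr (- ?N (real i * ?h n)) *
      (?L (real (Suc i) * ?h n) - ?L (real i * ?h n))) =
      (\<lambda>n. discounted_sum c (\<lambda>i. increment (?h n) i \<omega>) (j * Suc n))"
    unfolding discounted_sum_increment[OF X0] using \<open>\<delta> > 0\<close> by (simp add: max_absorb2)
  finally show ?thesis unfolding functional_upto_def .
qed

lemma iexp_discounted_sum_increment:
  assumes "h \<ge> 0"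
  shows "(LINT \<omega>|M. iexp (z * discounted_sum c (\<lambda>i. increment h i \<omega>) m)) =
    discounted_char c (distr M borel (X h)) m z"
proof -
  have "indep_vars (\<lambda>_. borel) (increment h) {..<n}" for n
  proof -
    have "\<forall>(n::nat) \<tau>. 0 \<le> \<tau> 0 \<and> (\<forall>i<n. \<tau> i \<le> \<tau> (Suc i)) \<longrightarrow>
        indep_vars (\<lambda>_. borel) (\<lambda>i \<omega>. X (\<tau> (Suc i)) \<omega> - X (\<tau> i) \<omega>) {..<n}"
      using cpp by (simp add: compound_poisson_process_def levy_process_def)
    from this[rule_format, of "\<lambda>i. real i * h" n] show ?thesis
      using assms by (simp add: increment_def[abs_def] mult_right_mono)
  qed
  moreover have "distr M borel (increment h i) = distr M borel (X h)" for i
    using distr_increment[of "real i * h" h] assms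
    by (simp add: increment_def[abs_def] algebra_simps)
  ultimately show ?thesis
    using iexp_discounted_sum[of c "increment h" "distr M borel (X h)" z 0 m] c_gt_1 by simp
qed

text \<open>The recursion integrates \<open>?F\<close> against the law of \<open>X h\<close>. Its
  values at the origin and at the three jump points are exactly the terms of the generator, so the
  small-time expansion applies.\<close>

lemma discounted_char_step:
  assumes "h \<ge> 0"
  defines "a \<equiv> discounted_char c (distr M borel (X h))"
  shows "norm (a (Suc m) z - a m z - h * jump_generator c k u v w (a m) z)
    \<le> (3 * (u + v + w)\<^sup>2) * h\<^sup>2"
proof -
  let ?P = "distr M borel (X h)" and ?\<kappa> = "c powi (- k)"
  let ?D = "jump_counts_pmf (u * h) (v * h) (w * h)"
  have P: "prob_space ?P" using assms by (intro prob_space_distr) simp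
  note [measurable] = borel_measurable_discounted_char[OF P sets_distr] borel_measurable_fst_snd_real
  let ?F = "\<lambda>x. iexp (z * snd x) * a m (z * c powr (- fst x))"
  have "a (Suc m) z = (LINT x|?P. ?F x)" by (simp add: a_def)
  also have "\<dots> = (LINT x|?D. ?F (jump_total ?\<kappa> x))"
    unfolding distr_X[OF assms(1)] by (subst integral_distr) (auto simp: a_def)
  finally have eq: "a (Suc m) z = (LINT x|?D. ?F (jump_total ?\<kappa> x))" .
  have "norm (?F x) \<le> 1" for x
    using norm_discounted_char_le_1[OF P sets_distr] by (simp add: norm_mult a_def)
  from jump_counts_small_time[OF uvw assms(1), of ?F ?\<kappa>, OF this]
  show ?thesis
    using c_gt_1 unfolding eq
    by (simp add: jump_generator_def powr_minus divide_inverse)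
qed

text \<open>Almost surely this is \<open>functional_upto\<close> at time
  \<open>real j * \<delta>\<close>; as a limit of measurable sums it is measurable on all of
  \<open>M\<close>.\<close>

definition partial_functional :: "real \<Rightarrow> nat \<Rightarrow> 'a \<Rightarrow> real" where
  "partial_functional \<delta> j \<omega> =
    lim (\<lambda>n. discounted_sum c (\<lambda>i. increment (\<delta> / real (Suc n)) i \<omega>) (j * Suc n))"

lemma discounted_sum_increment_measurable [measurable]:
  "h \<ge> 0 \<Longrightarrow> (\<lambda>\<omega>. discounted_sum c (\<lambda>i. increment h i \<omega>) m) \<in> borel_measurable M"
  unfolding increment_def by (intro borel_measurable_discounted_sum borel_measurable_diff X_measurable) auto

lemma partial_functional_measurable:
  "\<delta> > 0 \<Longrightarrow> partial_functional \<delta> j \<in> borel_measurable M"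
  unfolding partial_functional_def by (intro borel_measurable_lim_metric) simp

lemma iexp_tendsto:
  fixes S :: "nat \<Rightarrow> 'a \<Rightarrow> real"
  assumes [measurable]: "\<And>n. S n \<in> borel_measurable M" "W \<in> borel_measurable M"
    and "AE \<omega> in M. (\<lambda>n. S n \<omega>) \<longlonglongrightarrow> W \<omega>"
  shows "(\<lambda>n. LINT \<omega>|M. iexp (z * S n \<omega>)) \<longlonglongrightarrow> (LINT \<omega>|M. iexp (z * W \<omega>))"
proof (rule integral_dominated_convergence[where w = "\<lambda>_. 1"])
  show "AE \<omega> in M. (\<lambda>n. iexp (z * S n \<omega>)) \<longlonglongrightarrow> iexp (z * W \<omega>)"
    using assms(3) by eventually_elim (intro tendsto_intros)
qed auto

lemma discounted_char_tendsto:
  assumes "\<delta> > 0"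
  shows "(\<lambda>n. discounted_char c (distr M borel (X (\<delta> / real (Suc n)))) (j * Suc n) z)
    \<longlonglongrightarrow> (LINT \<omega>|M. iexp (z * partial_functional \<delta> j \<omega>))"
proof -
  have "AE \<omega> in M. (\<lambda>n. discounted_sum c (\<lambda>i. increment (\<delta> / real (Suc n)) i \<omega>) (j * Suc n))
      \<longlonglongrightarrow> partial_functional \<delta> j \<omega>"
    using AE_good_path
  proof eventually_elim
    case (elim \<omega>)
    note lim = discounted_sum_tendsto_functional_upto[OF elim assms, of j]
    show ?case unfolding partial_functional_def limI[OF lim] by (rule lim)
  qed
  then show ?thesis
    using assms by (subst iexp_discounted_sum_increment[symmetric], simp)
      (intro iexp_tendsto partial_functional_measurable discounted_sum_increment_measurable, auto)
qed

lemma partial_functional_tendsto: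
  assumes "\<delta> > 0"
  shows "(\<lambda>j. LINT \<omega>|M. iexp (z * partial_functional \<delta> j \<omega>)) \<longlonglongrightarrow> (LINT \<omega>|M. iexp (z * V \<omega>))"
proof (rule iexp_tendsto)
  show "AE \<omega> in M. (\<lambda>j. partial_functional \<delta> j \<omega>) \<longlonglongrightarrow> V \<omega>"
    using AE_good_path V_lim
  proof eventually_elim
    case (elim \<omega>)
    have "partial_functional \<delta> j \<omega> = functional_upto c X (real j * \<delta>) \<omega>" for j
      unfolding partial_functional_def
      using discounted_sum_tendsto_functional_upto[OF elim(1) assms] by (rule limI)
    moreover have "filterlim (\<lambda>j. real j * \<delta>) at_top sequentially"
      using assms by (intro filterlim_at_top_mult_tendsto_pos[OF tendsto_const] filterlim_real_sequentially)
    ultimately show ?case using filterlim_compose[OF elim(2)] by simp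
  qed
qed (use assms partial_functional_measurable in auto)

text \<open>The Euler bound over one period from \<open>j * \<delta>\<close> to
  \<open>Suc j * \<delta>\<close> survives mesh refinement. As \<open>j\<close> grows, the
  characteristic functions at both ends converge to that of \<open>V\<close>, so only
  \<open>\<delta>\<close> times the generator is left, bounded by
  \<open>C * \<delta>\<^sup>2\<close>. Dividing by \<open>\<delta>\<close> and letting it tend to
  \<open>0\<close> finishes.\<close>

lemma jump_generator_eq_0:
  "jump_generator c k u v w (\<lambda>y. LINT \<omega>|M. iexp (y * V \<omega>)) z = 0"
proof -
  let ?G = "jump_generator c k u v w" and ?\<phi> = "\<lambda>y. LINT \<omega>|M. iexp (y * V \<omega>)"
  define K where "K = 3 * (u + v + w)\<^sup>2"
  define C where "C = K + 2 * (u + v + w) * (2 * (u + v + w) + K)"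
  have "norm (?G ?\<phi> z) \<le> C * \<delta>" if \<delta>: "0 < \<delta>" "\<delta> \<le> 1" for \<delta>
  proof -
    define \<phi> where "\<phi> j y = (LINT \<omega>|M. iexp (y * partial_functional \<delta> j \<omega>))" for j y
    define a where "a n = discounted_char c (distr M borel (X (\<delta> / real (Suc n))))" for n
    have a_lim: "(\<lambda>n. a n (j * Suc n) y) \<longlonglongrightarrow> \<phi> j y" for j y
      using discounted_char_tendsto[OF \<delta>(1)] by (simp add: a_def \<phi>_def)
    have "norm (a n (j * Suc n + Suc n) z - a n (j * Suc n) z -
        complex_of_real (real (Suc n) * (\<delta> / real (Suc n))) * ?G (a n (j * Suc n)) z)
      \<le> C * (real (Suc n) * (\<delta> / real (Suc n)))\<^sup>2" for n j
      unfolding C_def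
    proof (rule Euler_scheme_error[OF uvw])
      show "0 \<le> \<delta> / real (Suc n)" "\<delta> / real (Suc n) \<le> 1" "K \<ge> 0"
        using \<delta> by (auto simp: K_def divide_le_eq)
      then show "norm (a n m y) \<le> 1" for m y
        unfolding a_def by (intro norm_discounted_char_le_1 prob_space_distr) auto
      show "norm (a n (Suc m) y - a n m y - complex_of_real (\<delta> / real (Suc n)) * ?G (a n m) y)
          \<le> K * (\<delta> / real (Suc n))\<^sup>2" for m y
        unfolding a_def K_def using \<delta> by (intro discounted_char_step) auto
    qed
    moreover have "real (Suc n) * (\<delta> / real (Suc n)) = \<delta>" "j * Suc n + Suc n = Suc j * Suc n" for n j
      by (simp_all del: of_nat_Suc)
    ultimately have bound: "norm (a n (Suc j * Suc n) z - a n (j * Suc n) z - \<delta> * ?G (a n (j * Suc n)) z)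
      \<le> C * \<delta>\<^sup>2" for n j
      by (simp only:)
    \<comment> \<open>First limit: the mesh tends to \<open>0\<close> while \<open>\<delta>\<close>
      and \<open>j\<close> are fixed.\<close>
    have "norm (\<phi> (Suc j) z - \<phi> j z - \<delta> * ?G (\<phi> j) z) \<le> C * \<delta>\<^sup>2" for j
    proof (rule LIMSEQ_le_const2)
      show "(\<lambda>n. norm (a n (Suc j * Suc n) z - a n (j * Suc n) z - \<delta> * ?G (a n (j * Suc n)) z))
          \<longlonglongrightarrow> norm (\<phi> (Suc j) z - \<phi> j z - \<delta> * ?G (\<phi> j) z)"
        unfolding jump_generator_def by (intro tendsto_intros a_lim)
    qed (use bound in blast)
    \<comment> \<open>Second limit: time tends to infinity, and the increment over one period
      disappears.\<close>
    moreover have "(\<lambda>j. norm (\<phi> (Suc j) z - \<phi> j z - \<delta> * ?G (\<phi> j) z)) \<longlonglongrightarrow>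
        norm (?\<phi> z - ?\<phi> z - \<delta> * ?G ?\<phi> z)"
      unfolding jump_generator_def \<phi>_def
      by (intro tendsto_intros partial_functional_tendsto \<delta> LIMSEQ_Suc)
    ultimately have "norm (?\<phi> z - ?\<phi> z - \<delta> * ?G ?\<phi> z) \<le> C * \<delta>\<^sup>2"
      by (intro LIMSEQ_le_const2) auto
    then show ?thesis using \<delta> by (simp add: norm_mult power2_eq_square)
  qed
  then have "eventually (\<lambda>\<delta>. norm (?G ?\<phi> z) \<le> C * \<delta>) (at_right 0)"
    unfolding eventually_at_right_field by (intro exI[of _ 1]) auto
  moreover have "((\<lambda>\<delta>. C * \<delta>) \<longlongrightarrow> C * 0) (at_right 0)" by (intro tendsto_intros)
  ultimately have "norm (?G ?\<phi> z) \<le> C * 0"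
    by (intro tendsto_lowerbound) auto
  then show ?thesis by simp
qed

end

lemma is_mu_functional_char:
  assumes "c > 1" "p + q + r = 1" "is_mu c p q r k M \<mu>"
  shows "functional_char c p q r k \<mu>"
proof -
  obtain u v w X V where uvw: "0 \<le> u" "0 \<le> v" "0 \<le> w"
    and pqr: "p = u / (u + v + w)" "q = v / (u + v + w)" "r = w / (u + v + w)"
    and X: "compound_poisson_process M (nu c k u v w) X" and V: "V \<in> borel_measurable M"
      "AE \<omega> in M. ((\<lambda>t. functional_upto c X t \<omega>) \<longlongrightarrow> V \<omega>) at_top"
    and \<mu>: "\<mu> = distr M borel V"
    using assms(3) unfolding is_mu_def by (elim exE conjE) (rule that; assumption)
  \<comment> \<open>With total mass zero all three ratios would be \<open>0\<close>, as division by
    zero gives \<open>0\<close>, contradicting their sum being \<open>1\<close>.\<close>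
  have "u + v + w \<noteq> 0" using assms(2) pqr by auto
  interpret prob_space M
    using X by (simp add: compound_poisson_process_def levy_process_def)
  interpret exponential_functional M c k u v w X V
    by unfold_locales (use assms(1) uvw X V in auto)
  have char: "char \<mu> z = (LINT \<omega>|M. iexp (z * V \<omega>))" for z
    unfolding char_def \<mu> by (subst integral_distr) auto
  show ?thesis
    unfolding functional_char_def
  proof (intro conjI allI)
    show "real_distribution \<mu>" unfolding \<mu> by (intro real_distribution_distr) simp
    fix z
    let ?\<Lambda> = "complex_of_real (u + v + w)"
    have "u * char \<mu> (z / c) + v * (iexp z * char \<mu> z) +
        w * (iexp (z * c powi (- k)) * char \<mu> (z / c)) - ?\<Lambda> * char \<mu> z = 0"
      using jump_generator_eq_0[of z] unfolding jump_generator_def char .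
    moreover have "complex_of_real u = ?\<Lambda> * p" "complex_of_real v = ?\<Lambda> * q" "complex_of_real w = ?\<Lambda> * r"
      unfolding pqr of_real_mult[symmetric] using \<open>u + v + w \<noteq> 0\<close> by simp_all
    ultimately have "?\<Lambda> * (p * char \<mu> (z / c) + q * (iexp z * char \<mu> z) +
        r * (iexp (z * c powi (- k)) * char \<mu> (z / c)) - char \<mu> z) = 0"
      by (simp only: algebra_simps)
    moreover have "?\<Lambda> \<noteq> 0" using \<open>u + v + w \<noteq> 0\<close> of_real_eq_0_iff by blast
    ultimately have "p * char \<mu> (z / c) + q * (iexp z * char \<mu> z) +
        r * (iexp (z * c powi (- k)) * char \<mu> (z / c)) = char \<mu> z"
      by (simp only: mult_eq_0_iff) simp
    then show "char \<mu> z * (1 - q * iexp z) = (p + r * iexp (z * c powi (- k))) * char \<mu> (z / c)"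
      by (simp add: algebra_simps)
  qed
qed

theorem theorem3p1:
  fixes c p q r :: real and k :: int
    and M\<^sub>k :: "'a measure" and M\<^sub>0 :: "'b measure"
    and \<mu>\<^sub>k \<mu>\<^sub>0 :: "real measure"
  assumes "c > 1"
    and "p \<ge> 0" and "q \<ge> 0" and "r \<ge> 0"
    and "p + q + r = 1"
    and "p + r > 0" and "q + r > 0"
    and "is_mu c p q r k M\<^sub>k \<mu>\<^sub>k"
    and "is_mu c p q r 0 M\<^sub>0 \<mu>\<^sub>0"
  shows "(absolutely_continuous lborel \<mu>\<^sub>k \<longleftrightarrow> absolutely_continuous lborel \<mu>\<^sub>0) \<and>
    (continuous_singular \<mu>\<^sub>k \<longleftrightarrow> continuous_singular \<mu>\<^sub>0) \<and>
    measure_dim \<mu>\<^sub>k = measure_dim \<mu>\<^sub>0"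
proof -
  interpret jump_ratios c p q r by unfold_locales (use assms in auto)
  have k: "functional_char c p q r k \<mu>\<^sub>k" and zero: "functional_char c p q r 0 \<mu>\<^sub>0"
    using assms is_mu_functional_char by blast+
  show ?thesis
  \<comment> \<open>The comparison runs from a lower level to a higher one, so the sign of
    \<open>k\<close> decides which law takes which role.\<close>
  proof (cases "k \<ge> 0")
    case True
    with functional_char_same_type[OF zero, of "nat k" \<mu>\<^sub>k] k show ?thesis by simp
  next
    case False
    with functional_char_same_type[OF k, of "nat (- k)" \<mu>\<^sub>0] zero show ?thesis by simp
  qed
qed

end
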